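(* Let $R$ be a complete discrete valuation ring of characteristic $2$ with maximal ideal $\mathfrak{p}$ and finite residue field $k=R/\mathfrak{p}$ with $|k|>9$. Let $H$ be a closed subgroup of $\mathrm{GL}_2(R)$ whose image in $\mathrm{GL}_2(k)$ contains $\mathrm{SL}_2(k)$. Let $H'\subset H$ be the intersection of all closed subgroups of index $2$ in $H$, and assume that $\mathrm{Tr}\,\mathrm{Ad}(H')$ topologically generates the subring $R^2=\{x^2\mid x\in R\}$. Then $H^{\mathrm{der}}=\mathrm{SL}_2(R)$.
   Context: $\mathrm{Ad}$ is the adjoint representation of $\mathrm{GL}_2$ on $\mathfrak{gl}_2$, $X\mapsto hXh^{-1}$, and $\mathrm{Tr}\,\mathrm{Ad}(H')=\{\mathrm{Tr}\,\mathrm{Ad}(h)\mid h\in H'\}$. "Topologically generates" means the smallest closed subring containing the set is the given ring. $H^{\mathrm{der}}$ is the closure of the derived group of $H$. *)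

theory Defs
  imports "HOL-Analysis.Analysis" "HOL-Algebra.Solvable_Groups"
begin

text \<open>A discrete valuation ring is modelled as an integral domain (the whole type 'a)
  together with a uniformizer: a nonzero non-unit element such that every nonzero element
  is a unit times a power of unif. The maximal ideal is the ideal generated by it.\<close>

definition dvr_uniformizer :: "'a::idom \<Rightarrow> bool" where
  "dvr_uniformizer unif \<longleftrightarrow> unif \<noteq> 0 \<and> \<not> unif dvd 1 \<and>
     (\<forall>x. x \<noteq> 0 \<longrightarrow> (\<exists>u n. u dvd 1 \<and> x = u * unif ^ n))"

text \<open>Completeness for the p-adic topology: every p-adic Cauchy sequence converges.\<close>
definition padic_complete :: "'a::idom \<Rightarrow> bool" where
  "padic_complete unif \<longleftrightarrow>
     (\<forall>x :: nat \<Rightarrow> 'a.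
        (\<forall>n. \<exists>N. \<forall>m\<ge>N. \<forall>m'\<ge>N. unif ^ n dvd (x m - x m')) \<longrightarrow>
        (\<exists>l. \<forall>n. \<exists>N. \<forall>m\<ge>N. unif ^ n dvd (x m - l)))"

text \<open>The residue field k = R / (uniformizer), as a set of equivalence classes.\<close>
definition residue_field :: "'a::idom \<Rightarrow> 'a set set" where
  "residue_field unif = UNIV // {(x, y). unif dvd (x - y)}"

text \<open>p-adic closure of a set of elements of R and of a set of 2x2 matrices over R.\<close>
definition padic_closure_elt :: "'a::idom \<Rightarrow> 'a set \<Rightarrow> 'a set" where
  "padic_closure_elt unif S = {x. \<forall>n. \<exists>y\<in>S. unif ^ n dvd (y - x)}"

definition padic_closure :: "'a::idom \<Rightarrow> ('a^2^2) set \<Rightarrow> ('a^2^2) set" where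
  "padic_closure unif S = {M. \<forall>n. \<exists>A\<in>S. \<forall>i j. unif ^ n dvd (A$i$j - M$i$j)}"

text \<open>The group GL_2(R), as a HOL-Algebra monoid structure.\<close>
definition GL2 :: "('a::comm_ring_1^2^2) monoid" where
  "GL2 = \<lparr>carrier = {A. det A dvd 1}, mult = (**), one = mat 1\<rparr>"

definition SL2 :: "('a::comm_ring_1^2^2) set" where
  "SL2 = {A. det A = 1}"

text \<open>Closed subgroups of index 2 of H (index computed in the group H).\<close>
definition closed_index2_subgroups :: "'a::idom \<Rightarrow> ('a^2^2) set \<Rightarrow> ('a^2^2) set set" where
  "closed_index2_subgroups unif H =
     {K. K \<subseteq> H \<and> subgroup K GL2 \<and> padic_closure unif K = K \<and>
         card (rcosets\<^bsub>GL2\<lparr>carrier := H\<rparr>\<^esub> K) = 2}"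

text \<open>H' : the intersection of all closed subgroups of index 2 in H (equal to H if there are none).\<close>
definition Hprime :: "'a::idom \<Rightarrow> ('a^2^2) set \<Rightarrow> ('a^2^2) set" where
  "Hprime unif H = H \<inter> \<Inter> (closed_index2_subgroups unif H)"

text \<open>Elementary matrix E_ij, a basis of gl_2.\<close>
definition elem_mat :: "2 \<Rightarrow> 2 \<Rightarrow> 'a::comm_ring_1^2^2" where
  "elem_mat i j = (\<chi> k l. if k = i \<and> l = j then 1 else 0)"

text \<open>Trace of Ad(h): X \<mapsto> h X h^-1 on gl_2, computed in the basis E_ij.\<close>
definition trace_Ad :: "'a::comm_ring_1^2^2 \<Rightarrow> 'a" where
  "trace_Ad h = (\<Sum>i\<in>UNIV. \<Sum>j\<in>UNIV. (h ** elem_mat i j ** inv\<^bsub>GL2\<^esub> h) $ i $ j)"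

definition closed_subring :: "'a::idom \<Rightarrow> 'a set \<Rightarrow> bool" where
  "closed_subring unif S \<longleftrightarrow> 0 \<in> S \<and> 1 \<in> S \<and>
     (\<forall>x\<in>S. \<forall>y\<in>S. x + y \<in> S \<and> x - y \<in> S \<and> x * y \<in> S) \<and>
     padic_closure_elt unif S \<subseteq> S"

text \<open>The smallest closed subring containing T.\<close>
definition top_generated_subring :: "'a::idom \<Rightarrow> 'a set \<Rightarrow> 'a set" where
  "top_generated_subring unif T = \<Inter> {S. closed_subring unif S \<and> T \<subseteq> S}"

end

theory Submission
  imports Defs
begin

text \<open>
  Let \<open>t\<close> be the uniformizer and \<open>D\<close> the derived group of \<open>H\<close>. It suffices that \<open>D\<close> maps onto
  \<open>SL\<^sub>2(R/t\<^sup>n)\<close> for all \<open>n\<close>, by induction on \<open>n\<close>; for \<open>n = 1\<close> this holds because \<open>SL\<^sub>2(k)\<close> is perfect.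
  In the step from \<open>n\<close> to \<open>n + 1\<close>, let \<open>W\<close> be the set of \<open>X\<close> in \<open>sl\<^sub>2(k)\<close> such that \<open>1 + t\<^sup>n X\<close> lifts to \<open>D\<close>.
  It is stable under the adjoint action, so it is everything as soon as it contains a nonscalar matrix.

  If \<open>W\<close> is scalar, let \<open>E\<close> be the preimage in \<open>SL\<^sub>2(R)\<close> of the image of \<open>D\<close> modulo \<open>t\<^sup>n\<^sup>+\<^sup>1\<close> and modulo
  scalars congruent to 1 modulo \<open>t\<^sup>n\<close>. After a conjugation \<open>E\<close> contains all diagonal matrices, so the
  set \<open>V\<close> of all \<open>x\<close> whose upper unipotent matrix is in \<open>E\<close> is closed under multiplication by squares,
  surjects onto \<open>R/t\<^sup>n\<close>, and meets \<open>t\<^sup>n R\<close> in \<open>t\<^sup>n\<^sup>+\<^sup>1 R\<close>. For \<open>n \<ge> 2\<close> this is absurd, because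
  \<open>t\<^sup>n\<close> is a square times 1 or \<open>t\<close>. For \<open>n = 1\<close> it follows that \<open>E\<close> is, modulo \<open>t\<^sup>2\<close>
  and scalars, the image of the entrywise Frobenius. Since \<open>H\<close> normalizes \<open>D\<close>, the same holds
  for \<open>H\<close>, and this bounds \<open>H'\<close>: the adjoint traces of \<open>H'\<close> are fourth powers modulo \<open>t\<^sup>4\<close>, so they
  do not generate \<open>t\<^sup>2\<close>.
\<close>

section \<open>Explicit two by two matrices\<close>

definition mat2 :: "'a \<Rightarrow> 'a \<Rightarrow> 'a \<Rightarrow> 'a \<Rightarrow> 'a::comm_ring_1^2^2" where
  "mat2 a b c d = vector [vector [a, b], vector [c, d]]"

lemma mat2_nth [simp]:
  "mat2 a b c d $ 1 $ 1 = a" "mat2 a b c d $ 1 $ 2 = b"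
  "mat2 a b c d $ 2 $ 1 = c" "mat2 a b c d $ 2 $ 2 = d"
  by (simp_all add: mat2_def)

lemma mat2_eqI:
  fixes A B :: "'a::comm_ring_1^2^2"
  assumes "A$1$1 = B$1$1" "A$1$2 = B$1$2" "A$2$1 = B$2$1" "A$2$2 = B$2$2"
  shows "A = B"
  using assms by (simp add: vec_eq_iff forall_2)

lemma mat2_eta: "mat2 (A$1$1) (A$1$2) (A$2$1) (A$2$2) = A"
  by (rule mat2_eqI) simp_all

lemma mat2_cases:
  obtains a b c d where "A = mat2 a b c d"
  by (metis mat2_eta)

lemma mat2_mult [simp]:
  "mat2 a b c d ** mat2 a' b' c' d' =
    mat2 (a * a' + b * c') (a * b' + b * d') (c * a' + d * c') (c * b' + d * d')"
  by (rule mat2_eqI) (simp_all add: matrix_matrix_mult_def sum_2)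

lemma det_mat2 [simp]: "det (mat2 a b c d) = a * d - b * c"
  by (simp add: det_2)

lemma mat2_one: "mat 1 = mat2 1 0 0 1"
  by (rule mat2_eqI) (simp_all add: mat_def)

lemma mat2_inj [simp]:
  "mat2 a b c d = mat2 a' b' c' d' \<longleftrightarrow> a = a' \<and> b = b' \<and> c = c' \<and> d = d'"
  by (metis mat2_nth)

text \<open>The adjugate is a division-free inverse: exact on \<open>SL2\<close>, and up to the
  scalar \<open>det A\<close> in general.\<close>

definition adj2 :: "'a::comm_ring_1^2^2 \<Rightarrow> 'a^2^2" where
  "adj2 A = mat2 (A$2$2) (- (A$1$2)) (- (A$2$1)) (A$1$1)"

lemma adj2_mat2 [simp]: "adj2 (mat2 a b c d) = mat2 d (- b) (- c) a"
  by (simp add: adj2_def)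

abbreviation scal :: "'a::comm_ring_1 \<Rightarrow> 'a^2^2" where
  "scal c \<equiv> mat2 c 0 0 c"

lemma adj2_mult: "adj2 (A ** B) = adj2 B ** adj2 A"
  by (rule mat2_cases[of A], rule mat2_cases[of B]) (simp add: algebra_simps)

lemma mult_adj2:
  fixes A :: "'a::comm_ring_1^2^2"
  shows "A ** adj2 A = scal (det A)" "adj2 A ** A = scal (det A)"
  by (rule mat2_cases[of A], simp add: algebra_simps)+

lemma det_adj2 [simp]: "det (adj2 A) = det A"
  by (rule mat2_cases[of A]) (simp add: algebra_simps)

lemma adj2_adj2 [simp]: "adj2 (adj2 A) = A"
  by (rule mat2_cases[of A]) simp

lemma scal_commute:
  fixes A :: "'a::comm_ring_1^2^2"
  shows "scal c ** A = A ** scal c"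
  by (rule mat2_cases[of A]) (simp add: algebra_simps)

lemma scal_mult_scal:
  fixes A :: "'a::comm_ring_1^2^2"
  shows "scal c ** (scal d ** A) = scal (c * d) ** A"
  by (rule mat2_cases[of A]) (simp add: algebra_simps)

lemma scal_one: "scal 1 = mat 1"
  by (simp add: mat2_one)

lemma det_scal_mult:
  fixes A :: "'a::comm_ring_1^2^2"
  shows "det (scal c ** A) = c\<^sup>2 * det A"
  by (rule mat2_cases[of A]) (simp add: algebra_simps power2_eq_square)

lemma adj2_scal_mult:
  fixes A :: "'a::comm_ring_1^2^2"
  shows "adj2 (scal c ** A) = scal c ** adj2 A"
  by (rule mat2_cases[of A]) (simp add: algebra_simps)

abbreviation up :: "'a::comm_ring_1 \<Rightarrow> 'a^2^2" where "up x \<equiv> mat2 1 x 0 1"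
abbreviation lo :: "'a::comm_ring_1 \<Rightarrow> 'a^2^2" where "lo x \<equiv> mat2 1 0 x 1"
abbreviation dg :: "'a::comm_ring_1 \<Rightarrow> 'a \<Rightarrow> 'a^2^2" where "dg x y \<equiv> mat2 x 0 0 y"

lemma SL2_mat2 [simp]: "mat2 a b c d \<in> SL2 \<longleftrightarrow> a * d - b * c = 1"
  by (simp add: SL2_def)

lemma SL2_one [simp]: "mat 1 \<in> SL2"
  by (simp add: SL2_def)

lemma SL2_mult: "A \<in> SL2 \<Longrightarrow> B \<in> SL2 \<Longrightarrow> A ** B \<in> SL2"
  by (simp add: SL2_def det_mul)

lemma SL2_adj2: "A \<in> SL2 \<Longrightarrow> adj2 A \<in> SL2"
  by (simp add: SL2_def)

lemma SL2_inverse: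
  "A \<in> SL2 \<Longrightarrow> A ** adj2 A = mat 1" "A \<in> SL2 \<Longrightarrow> adj2 A ** A = mat 1"
  by (simp_all add: SL2_def mult_adj2 scal_one)

subsection \<open>Entrywise congruence\<close>

lemma dvd_diff_sym:
  fixes m :: "'a::comm_ring_1"
  shows "m dvd a - b \<Longrightarrow> m dvd b - a"
  by (metis dvd_minus_iff minus_diff_eq)

lemma dvd_diff_mult:
  fixes m :: "'a::comm_ring_1"
  assumes "m dvd a - a'" "m dvd b - b'"
  shows "m dvd a * b - a' * b'"
proof -
  have "a * b - a' * b' = (a - a') * b + a' * (b - b')"
    by (simp add: algebra_simps)
  then show ?thesis
    using assms by simp
qed

lemma dvd_diff_add:
  fixes m :: "'a::comm_ring_1"
  assumes "m dvd a - a'" "m dvd b - b'"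
  shows "m dvd (a + b) - (a' + b')"
  using dvd_add[OF assms] by (simp add: algebra_simps)

lemma dvd_diff_trans:
  fixes m :: "'a::comm_ring_1"
  assumes "m dvd a - b" "m dvd b - c"
  shows "m dvd a - c"
  using dvd_add[OF assms] by simp

lemma dvd_diff_diff:
  fixes m :: "'a::comm_ring_1"
  assumes "m dvd a - a'" "m dvd b - b'"
  shows "m dvd (a - b) - (a' - b')"
  using dvd_diff[OF assms] by (simp add: algebra_simps)

definition eqM :: "'a::comm_ring_1 \<Rightarrow> 'a^2^2 \<Rightarrow> 'a^2^2 \<Rightarrow> bool" where
  "eqM m A B \<longleftrightarrow> (\<forall>i j. m dvd A$i$j - B$i$j)"

lemma eqM_mat2 [simp]:
  "eqM m (mat2 a b c d) (mat2 a' b' c' d') \<longleftrightarrow>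
    m dvd a - a' \<and> m dvd b - b' \<and> m dvd c - c' \<and> m dvd d - d'"
  by (simp add: eqM_def forall_2)

lemma eqM_iff:
  "eqM m A B \<longleftrightarrow> m dvd A$1$1 - B$1$1 \<and> m dvd A$1$2 - B$1$2 \<and>
     m dvd A$2$1 - B$2$1 \<and> m dvd A$2$2 - B$2$2"
  by (simp add: eqM_def forall_2)

lemma eqM_refl [simp]: "eqM m A A"
  by (simp add: eqM_def)

lemma eqM_sym: "eqM m A B \<Longrightarrow> eqM m B A"
  unfolding eqM_def using dvd_diff_sym by blast

lemma eqM_trans [trans]: "eqM m A B \<Longrightarrow> eqM m B C \<Longrightarrow> eqM m A C"
  unfolding eqM_def by (metis dvd_diff_trans)

lemma eqM_dvd: "eqM m A B \<Longrightarrow> l dvd m \<Longrightarrow> eqM l A B"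
  unfolding eqM_def using dvd_trans by blast

lemma eqM_mult:
  assumes "eqM m A B" "eqM m C D"
  shows "eqM m (A ** C) (B ** D)"
  using assms
  by (rule_tac mat2_cases[of A], rule_tac mat2_cases[of B], rule_tac mat2_cases[of C],
      rule_tac mat2_cases[of D]) (simp add: dvd_diff_add dvd_diff_mult)

lemma eqM_adj2:
  assumes "eqM m A B"
  shows "eqM m (adj2 A) (adj2 B)"
proof -
  have "m dvd - x - - y" if "m dvd x - y" for x y
    using that by (metis minus_diff_minus dvd_minus_iff)
  then show ?thesis
    using assms by (simp add: eqM_iff adj2_def del: minus_diff_minus)
qed

lemma eqM_det: "eqM m A B \<Longrightarrow> m dvd det A - det B"
  by (rule mat2_cases[of A], rule mat2_cases[of B]) (simp add: dvd_diff_diff dvd_diff_mult)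

lemma eqM_scal: "m dvd c - c' \<Longrightarrow> eqM m (scal c ** A) (scal c' ** A)"
  by (rule eqM_mult) simp_all

subsection \<open>Subgroups of the special linear group\<close>

text \<open>Subgroups of the special linear group, with the adjugate as inverse so that no group
  structure has to be carried along.\<close>

definition subSL :: "('a::comm_ring_1^2^2) set \<Rightarrow> bool" where
  "subSL E \<longleftrightarrow> E \<subseteq> SL2 \<and> mat 1 \<in> E \<and> (\<forall>A\<in>E. \<forall>B\<in>E. A ** B \<in> E) \<and> (\<forall>A\<in>E. adj2 A \<in> E)"

lemma subSL_D:
  assumes "subSL E"
  shows "A \<in> E \<Longrightarrow> A \<in> SL2" "mat 1 \<in> E" "A \<in> E \<Longrightarrow> B \<in> E \<Longrightarrow> A ** B \<in> E"
    "A \<in> E \<Longrightarrow> adj2 A \<in> E"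
  using assms by (auto simp: subSL_def)

section \<open>Discrete valuation rings of characteristic two\<close>

locale dvr_char2 =
  fixes t :: "'a::idom"
  assumes dvr: "dvr_uniformizer t"
    and char2 [simp]: "(2::'a) = 0"
begin

lemma t_nz [simp]: "t \<noteq> 0"
  using dvr by (simp add: dvr_uniformizer_def)

lemma t_nonunit [simp]: "\<not> t dvd 1"
  using dvr by (simp add: dvr_uniformizer_def)

lemma double [simp]: "(x::'a) + x = 0"
  by (metis char2 mult_2 mult_zero_left)

lemma double_left [simp]: "(x::'a) + (x + y) = y"
  by (simp flip: add.assoc)

lemma double_right [simp]: "(x::'a) + y + y = x"
  by (simp add: add.assoc)

lemma move: "(x::'a) + y = z \<Longrightarrow> x = z + y"
  by (metis double_right)

lemma neg [simp]: "- (x::'a) = x"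
  by (metis double add_eq_0_iff)

text \<open>As a simp rule this turns differences into sums; congruences therefore appear below as
  \<open>m dvd x + y\<close>.\<close>

lemma diff_add [simp]: "(x::'a) - y = x + y"
  by (metis neg diff_conv_add_uminus)

lemma sq_add: "(x + y)\<^sup>2 = x\<^sup>2 + (y::'a)\<^sup>2"
  by (simp add: power2_sum char2)

lemma nonunit_dvd: "x dvd 1 \<or> t dvd x"
proof (cases "x = 0")
  case False
  then obtain u n where "u dvd 1" "x = u * t ^ n"
    using dvr by (auto simp: dvr_uniformizer_def)
  then show ?thesis
    by (cases n) auto
qed auto

lemma unitE:
  assumes "\<not> t dvd a"
  obtains a' where "a * a' = 1" "\<not> t dvd a'"
proof -
  obtain a' where "1 = a * a'"
    using nonunit_dvd[of a] assms by (auto elim: dvdE)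
  moreover from this have "\<not> t dvd a'"
    by (metis dvd_mult t_nonunit)
  ultimately show ?thesis
    using that by simp
qed

lemma t_prime: "t dvd a * b \<longleftrightarrow> t dvd a \<or> t dvd b"
proof
  assume ab: "t dvd a * b"
  show "t dvd a \<or> t dvd b"
  proof (rule ccontr)
    assume "\<not> (t dvd a \<or> t dvd b)"
    then obtain a' where "a * a' = 1" and b: "\<not> t dvd b"
      using unitE by metis
    then have "b = a' * (a * b)"
      by (metis mult.commute mult.left_commute mult_1_right)
    with ab b show False
      by (metis dvd_mult)
  qed
qed auto

lemma t_prime_power2 [simp]: "t dvd a\<^sup>2 \<longleftrightarrow> t dvd a"
  by (simp add: power2_eq_square t_prime)

lemma unit_cancel:
  assumes "\<not> t dvd a" "m dvd a * b"
  shows "m dvd b"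
proof -
  obtain a' where "a * a' = 1"
    using assms unitE by metis
  then have "b = a' * (a * b)"
    by (metis mult.commute mult.left_commute mult_1_right)
  then show ?thesis
    using assms by (metis dvd_mult)
qed

lemma dvd_add_unit: "t dvd b \<Longrightarrow> t dvd a + b \<longleftrightarrow> t dvd a"
  by (simp add: dvd_add_left_iff)

lemma t_power_dvd_power: "t ^ m dvd t ^ n \<longleftrightarrow> m \<le> n"
proof
  assume "t ^ m dvd t ^ n"
  show "m \<le> n"
  proof (rule ccontr)
    assume "\<not> m \<le> n"
    then have "t ^ n * t dvd t ^ m"
      by (metis le_imp_power_dvd not_less_eq_eq power_Suc2)
    then have "t ^ n * t dvd t ^ n * 1"
      using \<open>t ^ m dvd t ^ n\<close> by (metis dvd_trans mult_1_right)
    then show False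
      by (subst (asm) dvd_mult_cancel_left) simp
  qed
qed (rule le_imp_power_dvd)

text \<open>Separatedness of the adic topology: a unit times \<open>t ^ n\<close> is not divisible
  by \<open>t ^ Suc n\<close>.\<close>

lemma Inter_powers:
  assumes "\<And>n. t ^ n dvd x"
  shows "x = 0"
proof (rule ccontr)
  assume "x \<noteq> 0"
  then obtain u n where "u dvd 1" "x = u * t ^ n"
    using dvr by (auto simp: dvr_uniformizer_def)
  with assms[of "Suc n"] have "t ^ Suc n dvd t ^ n"
    by (metis dvd_trans nonunit_dvd t_nonunit unit_cancel)
  then show False
    by (simp only: t_power_dvd_power)
qed

lemma t_dvd_power [simp]: "t dvd t ^ n \<longleftrightarrow> 0 < n"
  using t_power_dvd_power[of 1 n] by auto

lemma t_power_dvd_Suc: "t ^ n dvd a \<Longrightarrow> t dvd b \<Longrightarrow> t ^ Suc n dvd a * b"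
  by (metis mult_dvd_mono power_Suc2)

lemma t_power_dvd_mult: "t ^ n dvd a \<Longrightarrow> t ^ m dvd b \<Longrightarrow> l \<le> n + m \<Longrightarrow> t ^ l dvd a * b"
  by (rule dvd_trans[OF le_imp_power_dvd[of l "n + m"]]) (simp_all add: power_add mult_dvd_mono)

text \<open>Elementary matrices generate the special linear group of a local ring. If the lower left
  entry is a unit, the matrix is upper times lower times upper; otherwise \<open>a\<close> is a
  unit, and splitting off a left factor \<open>lo 1\<close> reduces to that case.\<close>

lemma SL2_induct:
  fixes M :: "'a^2^2"
  assumes M: "M \<in> SL2" and P: "\<And>A B. P A \<Longrightarrow> P B \<Longrightarrow> P (A ** B)"
    and up: "\<And>x. P (up x)" and lo: "\<And>x. P (lo x)"
  shows "P M"
proof -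
  have *: "P (mat2 a b c d)" if "a * d - b * c = 1" and c: "\<not> t dvd c" for a b c d :: 'a
  proof -
    obtain c' where c': "c * c' = 1"
      using c unitE by metis
    have "mat2 a b c d = up ((a + 1) * c') ** (lo c ** up ((d + 1) * c'))"
    proof (simp, intro conjI)
      have e: "c * (c' * y) = y" "c' * (c * y) = y" for y
        using c' by (simp_all add: mult.commute[of c' c] flip: mult.assoc)
      show "a = 1 + (a + 1) * c' * c" "d = c * ((d + 1) * c') + 1"
        using e[of 1] by (simp_all add: algebra_simps e)
      have "b = c' * (b * c)"
        using e by (simp add: ac_simps)
      also have "b * c = a * d + 1"
        using that by (metis add.commute add_0_right diff_add double add.assoc)
      finally show "b = (d + 1) * c' + (a + 1) * c' * (c * ((d + 1) * c') + 1)"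
        using e[of 1] by (simp add: algebra_simps e)
    qed
    then show ?thesis
      using P up lo by metis
  qed
  obtain a b c d where M': "M = mat2 a b c d" "a * d - b * c = 1"
    using M by (metis SL2_mat2 mat2_cases)
  show ?thesis
  proof (cases "t dvd c")
    case True
    then have a: "\<not> t dvd a"
      using M' by (metis dvd_add dvd_mult dvd_mult2 t_nonunit diff_add)
    have "M = lo 1 ** mat2 a b (a + c) (b + d)"
      by (simp add: M' add.commute)
    moreover have "P (mat2 a b (a + c) (b + d))"
    proof (rule *)
      show "a * (b + d) - b * (a + c) = 1"
        using M' by (simp add: algebra_simps)
      show "\<not> t dvd a + c"
        using a True by (simp add: dvd_add_unit)
    qed
    ultimately show ?thesis
      using P lo by metis
  qed (use * M' in auto)
qed

text \<open>The equation \<open>det = 1\<close> is solved for one entry: for \<open>d\<close> if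
  \<open>a\<close> is a unit, otherwise for \<open>b\<close>, since then \<open>c\<close> is a
  unit.\<close>

lemma SL2_lift:
  assumes "t dvd det A - 1"
  obtains B where "B \<in> SL2" "eqM t B A"
proof -
  obtain a b c d where A: "A = mat2 a b c d"
    by (metis mat2_cases)
  have det: "t dvd a * d + b * c + 1"
    using assms by (simp add: A)
  show ?thesis
  proof (cases "t dvd a")
    case False
    then obtain a' where a': "a * a' = 1"
      using unitE by metis
    show ?thesis
    proof (rule that)
      show "mat2 a b c (a' * (1 + b * c)) \<in> SL2"
        using a' by (simp flip: mult.assoc)
      have "t dvd a' * (1 + b * c) + a' * (a * d)"
        using dvd_mult[OF det, of a'] by (simp add: algebra_simps)
      moreover have "a' * (a * d) = d"
        using a' by (metis mult.commute mult.left_commute mult_1_right)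
      ultimately show "eqM t (mat2 a b c (a' * (1 + b * c))) A"
        by (simp add: A)
    qed
  next
    case True
    then have "\<not> t dvd b * c"
      using det by (metis dvd_add_right_iff dvd_mult2 t_nonunit add.assoc)
    then obtain c' where c': "c * c' = 1"
      using unitE by (metis dvd_mult)
    show ?thesis
    proof (rule that)
      have "a * d + c' * (1 + a * d) * c = a * d + c * c' * (1 + a * d)"
        by (simp add: ac_simps)
      then show "mat2 a (c' * (1 + a * d)) c d \<in> SL2"
        using c' by (simp flip: add.assoc)
      have "t dvd c' * (1 + a * d) + c' * (b * c)"
        using dvd_mult[OF det, of c'] by (simp add: algebra_simps)
      moreover have "c' * (b * c) = b"
        using c' by (metis mult.commute mult.left_commute mult_1_right)
      ultimately show "eqM t (mat2 a (c' * (1 + a * d)) c d) A"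
        by (simp add: A)
    qed
  qed
qed

section \<open>The residue field\<close>

lemma residue_field_eq: "residue_field t = range (\<lambda>x. {y. t dvd x - y})"
  unfolding residue_field_def quotient_def by auto

lemma residue_class_eq_iff: "{z. t dvd x - z} = {z. t dvd y - z} \<longleftrightarrow> t dvd x - y"
proof
  assume "{z. t dvd x - z} = {z. t dvd y - z}"
  moreover have "y \<in> {z. t dvd y - z}"
    by simp
  ultimately show "t dvd x - y"
    by blast
next
  assume xy: "t dvd x - y"
  have "t dvd y - z" if "t dvd x - z" for z
    using dvd_diff_trans[OF dvd_diff_sym[OF xy] that] .
  moreover have "t dvd x - z" if "t dvd y - z" for z
    using dvd_diff_trans[OF xy that] .
  ultimately show "{z. t dvd x - z} = {z. t dvd y - z}"
    by blast
qed

text \<open>Squaring is additive, hence injective on residue classes, and an injective self-map of a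
  finite set is onto.\<close>

lemma residue_field_perfect:
  assumes "finite (residue_field t)"
  shows "\<exists>y. t dvd x - y\<^sup>2"
proof -
  define cl where "cl x = {z. t dvd x - z}" for x
  have cl: "cl x = cl y \<longleftrightarrow> t dvd x + y" for x y
    using residue_class_eq_iff[of x y] by (simp add: cl_def)
  \<comment> \<open>Squaring on classes, through a chosen representative; the next claim is
    independence of the choice.\<close>
  define sq where "sq X = cl ((SOME x. cl x = X)\<^sup>2)" for X
  have sq: "sq (cl x) = cl (x\<^sup>2)" for x
  proof -
    have "cl (SOME y. cl y = cl x) = cl x"
      by (rule someI[of "\<lambda>y. cl y = cl x" x]) simp
    then have "t dvd ((SOME y. cl y = cl x) + x)\<^sup>2"
      unfolding cl by simp
    then show ?thesis
      unfolding sq_def cl sq_add .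
  qed
  have "sq ` range cl = range cl"
  proof (rule endo_inj_surj)
    show "finite (range cl)"
      using assms by (simp add: residue_field_eq cl_def)
    show "sq ` range cl \<subseteq> range cl"
      by (auto simp: sq)
    show "inj_on sq (range cl)"
      by (auto simp: inj_on_def sq cl simp flip: sq_add)
  qed
  then have "cl x \<in> sq ` range cl"
    by simp
  then obtain y where "cl x = cl (y\<^sup>2)"
    by (auto simp: sq)
  then show ?thesis
    unfolding cl by auto
qed

text \<open>Otherwise every residue class would be a root of \<open>X (X + 1) (X\<^sup>2 + X + 1)\<close>.\<close>

lemma residue_field_ex_scalar:
  assumes "card (residue_field t) > 4"
  shows "\<exists>b. \<not> t dvd b \<and> \<not> t dvd 1 + b \<and> \<not> t dvd 1 + b + b\<^sup>2"
proof (rule ccontr)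
  assume "\<not> ?thesis"
  then have *: "t dvd b \<or> t dvd 1 + b \<or> t dvd 1 + b + b\<^sup>2" for b
    by blast
  define cl where "cl x = {z. t dvd x - z}" for x
  have cl: "cl x = cl y \<longleftrightarrow> t dvd x + y" for x y
    using residue_class_eq_iff[of x y] by (simp add: cl_def)
  \<comment> \<open>A root of \<open>1 + X + X\<^sup>2\<close> modulo \<open>t\<close> if there is
    one, and arbitrary otherwise.\<close>
  obtain c where c: "\<And>b. t dvd 1 + b + b\<^sup>2 \<Longrightarrow> t dvd 1 + c + c\<^sup>2"
    by blast
  have "residue_field t \<subseteq> {cl 0, cl 1, cl c, cl (1 + c)}"
  proof
    fix X
    assume "X \<in> residue_field t"
    then obtain b where b: "X = cl b"
      by (auto simp: residue_field_eq cl_def)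
    consider "t dvd b" | "t dvd 1 + b" | "t dvd 1 + b + b\<^sup>2"
      using * by blast
    then show "X \<in> {cl 0, cl 1, cl c, cl (1 + c)}"
    proof cases
      case 3
      then have "t dvd (1 + b + b\<^sup>2) + (1 + c + c\<^sup>2)"
        using c dvd_add by blast
      \<comment> \<open>Modulo \<open>t\<close>, two roots of this quadratic differ by 0 or
        1.\<close>
      also have "(1 + b + b\<^sup>2) + (1 + c + c\<^sup>2) = (b + c) * (b + (1 + c))"
        by (simp add: algebra_simps power2_eq_square)
      finally show ?thesis
        by (simp add: b cl t_prime)
    qed (simp_all add: b cl add.commute)
  qed
  then have "card (residue_field t) \<le> card {cl 0, cl 1, cl c, cl (1 + c)}"
    by (intro card_mono) simp_all
  also have "\<dots> \<le> 4"
    by (simp add: card_insert_if)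
  finally show False
    using assms by simp
qed

end

text \<open>The residue field enters through two facts: it is perfect, and it has an element outside
  the field with four elements.\<close>

locale dvr2 = dvr_char2 +
  assumes perfect: "\<And>x. \<exists>y. t dvd x - y\<^sup>2"
    and ex_scalar: "\<exists>b. \<not> t dvd b \<and> \<not> t dvd 1 + b \<and> \<not> t dvd 1 + b + b\<^sup>2"

section \<open>Rigid subgroups\<close>

definition cj :: "'a::comm_ring_1^2^2 \<Rightarrow> 'a^2^2 \<Rightarrow> 'a^2^2" where
  "cj P M = P ** M ** adj2 P"

lemma cj_mult: "P \<in> SL2 \<Longrightarrow> cj P (A ** B) = cj P A ** cj P B"
proof -
  assume P: "P \<in> SL2"
  have "cj P A ** cj P B = P ** A ** (adj2 P ** P) ** B ** adj2 P"
    by (simp add: cj_def matrix_mul_assoc)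
  then show ?thesis
    using P by (simp add: SL2_inverse cj_def matrix_mul_assoc)
qed

lemma cj_one: "P \<in> SL2 \<Longrightarrow> cj P (mat 1) = mat 1"
  by (simp add: cj_def SL2_inverse)

lemma cj_scal: "P \<in> SL2 \<Longrightarrow> cj P (scal c) = scal c"
  unfolding cj_def using scal_commute[of c P] by (metis SL2_inverse(1) matrix_mul_assoc matrix_mul_rid)

lemma cj_scal_mult: "P \<in> SL2 \<Longrightarrow> cj P (scal c ** M) = scal c ** cj P M"
  by (simp add: cj_mult cj_scal)

lemma cj_adj2: "adj2 (cj P A) = cj P (adj2 A)"
  by (simp add: cj_def adj2_mult matrix_mul_assoc)

lemma cj_cj: "cj P (cj Q M) = cj (P ** Q) M"
  by (simp add: cj_def adj2_mult matrix_mul_assoc)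

lemma cj_mat_one: "cj (mat 1) M = M"
proof -
  have "adj2 (mat 1) = (mat 1 :: 'a::comm_ring_1^2^2)"
    by (simp add: mat2_one)
  then show ?thesis
    by (simp add: cj_def)
qed

lemma cj_inverse:
  assumes "P \<in> SL2"
  shows "cj P (cj (adj2 P) M) = M" "cj (adj2 P) (cj P M) = M"
  using assms by (simp_all add: cj_cj SL2_inverse cj_mat_one)

lemma cj_SL2: "P \<in> SL2 \<Longrightarrow> M \<in> SL2 \<Longrightarrow> cj P M \<in> SL2"
  by (simp add: cj_def SL2_mult SL2_adj2)

lemma eqM_cj: "eqM m A B \<Longrightarrow> eqM m (cj P A) (cj P B)"
  by (simp add: cj_def eqM_mult)

lemma inverse_cancel:
  fixes a a' :: "'a::comm_ring_1"
  assumes "a * a' = 1"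
  shows "a * (a' * x) = x" "a' * (a * x) = x" "x * (a * a') = x"
proof -
  have "a * (a' * x) = a * a' * x" "a' * (a * x) = a * a' * x"
    by (simp_all only: ac_simps)
  then show "a * (a' * x) = x" "a' * (a * x) = x" "x * (a * a') = x"
    using assms by simp_all
qed

context dvr2
begin

text \<open>Modulo \<open>t ^ Suc n\<close> and scalars congruent to 1 modulo \<open>t ^ n\<close>,
  such an \<open>E\<close> maps bijectively onto the special linear group of level \<open>n\<close>;
  it encodes a splitting of the reduction map.\<close>

definition rigid :: "nat \<Rightarrow> ('a^2^2) set \<Rightarrow> bool" where
  "rigid n E \<longleftrightarrow> 0 < n \<and> subSL E \<and>
    (\<forall>M\<in>E. \<forall>N\<in>SL2. \<forall>z. eqM (t ^ Suc n) N (scal (1 + t ^ n * z) ** M) \<longrightarrow> N \<in> E) \<and>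
    (\<forall>M\<in>E. eqM (t ^ n) M (mat 1) \<longrightarrow> (\<exists>c. eqM (t ^ Suc n) M (scal c))) \<and>
    (\<forall>N\<in>SL2. \<exists>M\<in>E. eqM (t ^ n) M N)"

lemma rigidD:
  assumes "rigid n E"
  shows "0 < n" "subSL E"
    "M \<in> E \<Longrightarrow> N \<in> SL2 \<Longrightarrow> eqM (t ^ Suc n) N (scal (1 + t ^ n * z) ** M) \<Longrightarrow> N \<in> E"
    "M \<in> E \<Longrightarrow> eqM (t ^ n) M (mat 1) \<Longrightarrow> \<exists>c. eqM (t ^ Suc n) M (scal c)"
    "N \<in> SL2 \<Longrightarrow> \<exists>M\<in>E. eqM (t ^ n) M N"
  using assms unfolding rigid_def by blast+

lemma rigid_eqM:
  assumes "rigid n E" "M \<in> E" "N \<in> SL2" "eqM (t ^ Suc n) N M"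
  shows "N \<in> E"
  using rigidD(3)[OF assms(1-3), of 0] assms(4) by (simp add: scal_one)

lemma rigid_cj:
  assumes E: "rigid n E" and P: "P \<in> SL2"
  shows "rigid n (cj P ` E)"
proof -
  note E' = rigidD[OF E]
  note sub = subSL_D[OF E'(2)]
  have mem: "N \<in> cj P ` E" if "cj (adj2 P) N \<in> E" for N
    using that P by (metis cj_inverse(1) imageI)
  show ?thesis
    unfolding rigid_def
  proof (intro conjI ballI allI impI)
    show "0 < n"
      by (rule E')
    show "subSL (cj P ` E)"
      unfolding subSL_def using sub P
      by (auto simp: cj_SL2 cj_adj2 simp flip: cj_mult intro!: image_eqI[of _ _ "mat 1"] simp: cj_one)
  next
    fix M N z
    assume "M \<in> cj P ` E" and N: "N \<in> SL2" "eqM (t ^ Suc n) N (scal (1 + t ^ n * z) ** M)"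
    then obtain L where L: "L \<in> E" "M = cj P L"
      by auto
    have "eqM (t ^ Suc n) (cj (adj2 P) N) (scal (1 + t ^ n * z) ** L)"
      using eqM_cj[OF N(2), of "adj2 P"] P by (simp add: L cj_scal_mult SL2_adj2 cj_inverse)
    then have "cj (adj2 P) N \<in> E"
      using E'(3)[OF L(1)] N P by (meson SL2_adj2 cj_SL2)
    then show "N \<in> cj P ` E"
      by (rule mem)
  next
    fix M
    assume "M \<in> cj P ` E" and M: "eqM (t ^ n) M (mat 1)"
    then obtain L where L: "L \<in> E" "M = cj P L"
      by auto
    have "eqM (t ^ n) L (mat 1)"
      using eqM_cj[OF M, of "adj2 P"] P by (simp add: L cj_one SL2_adj2 cj_inverse)
    then obtain c where "eqM (t ^ Suc n) L (scal c)"
      using E'(4) L by blast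
    then have "eqM (t ^ Suc n) M (scal c)"
      using eqM_cj[of _ L "scal c" P] P by (simp add: L cj_scal)
    then show "\<exists>c. eqM (t ^ Suc n) M (scal c)" ..
  next
    fix N :: "'a^2^2"
    assume "N \<in> SL2"
    then obtain M where "M \<in> E" "eqM (t ^ n) M (cj (adj2 P) N)"
      using E'(5) P by (meson SL2_adj2 cj_SL2)
    then show "\<exists>M\<in>cj P ` E. eqM (t ^ n) M N"
      using eqM_cj[of "t ^ n" M "cj (adj2 P) N" P] P by (auto simp: cj_inverse)
  qed
qed

text \<open>Lift \<open>dg b b'\<close> to \<open>M\<close> in \<open>E\<close>. Its off-diagonal
  entries are divisible by \<open>t ^ n\<close>, and one Newton step makes them vanish modulo
  \<open>t ^ Suc n\<close>, where \<open>E\<close> no longer distinguishes matrices.\<close>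

lemma rigid_diagonalize:
  assumes E: "rigid n E"
  obtains P w w' where "P \<in> SL2" "dg w w' \<in> cj P ` E" "\<not> t dvd 1 + w"
proof -
  define q where "q = t ^ n"
  define r where "r = t ^ Suc n"
  have tq: "t dvd q" and rqq: "r dvd q * q" and qr: "q dvd r"
    using rigidD(1)[OF E] by (auto simp: q_def r_def t_power_dvd_Suc intro: dvd_trans[OF _ t_power_dvd_Suc])
  obtain b where b: "\<not> t dvd b" "\<not> t dvd 1 + b"
    using ex_scalar by blast
  obtain b' where b': "b * b' = 1"
    using b unitE by blast
  obtain M where M: "M \<in> E" "eqM q M (dg b b')"
    using rigidD(5)[OF E, of "dg b b'"] b' by (auto simp: q_def)
  obtain a x c d where M': "M = mat2 a x c d"
    by (metis mat2_cases)
  have q: "q dvd a + b" "q dvd x" "q dvd c" "q dvd d + b'"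
    using M by (simp_all add: M')
  \<comment> \<open>Modulo \<open>t\<close> the trace is \<open>b + b'\<close>, and
    \<open>b * (b + b') = (1 + b)\<^sup>2\<close>.\<close>
  have "\<not> t dvd a + d"
  proof
    assume "t dvd a + d"
    moreover have "t dvd a + b" "t dvd d + b'"
      using q dvd_trans[OF tq] by blast+
    ultimately have "t dvd b * ((a + d) + (a + b) + (d + b'))"
      by (metis dvd_add dvd_mult)
    also have "b * ((a + d) + (a + b) + (d + b')) = (1 + b)\<^sup>2"
      using b' by (simp add: algebra_simps sq_add power2_eq_square)
    finally show False
      using b by simp
  qed
  then obtain e where e: "(a + d) * e = 1"
    using unitE by blast
  \<comment> \<open>Conjugation by \<open>up p\<close> changes the upper right entry
    \<open>x\<close> to \<open>x + (a + d) * p + p * p * c\<close>; this \<open>p\<close> cancels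
    the linear part, and \<open>g\<close> does the same below the diagonal.\<close>
  define p where "p = x * e"
  define g where "g = c * e"
  have qpg: "q dvd p" "q dvd g"
    using q by (auto simp: p_def g_def)
  define P where "P = lo g ** up p"
  define K where "K = cj P M"
  have xe: "x = (a + d) * p" "c = (a + d) * g"
    unfolding p_def g_def using inverse_cancel(1)[OF e] by (simp_all only: mult.commute[of x] mult.commute[of c])
  have K: "K = mat2 (a + p * c + p * p * c * g) (p * p * c) (g * g * p * p * c) (d + p * c + p * p * c * g)"
    unfolding K_def cj_def P_def M'
    by (simp add: xe(1)) (simp add: xe(2) algebra_simps)
  obtain k1 k2 k3 k4 where K': "K = mat2 k1 k2 k3 k4"
    by (metis mat2_cases)
  have P: "P \<in> SL2"
    by (simp add: P_def)
  have KE: "K \<in> cj P ` E"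
    using M by (simp add: K_def)
  have rig: "rigid n (cj P ` E)"
    using E P by (rule rigid_cj)
  have r: "r dvd k2" "r dvd k3"
  proof -
    have "r dvd p * p"
      using rqq qpg by (meson dvd_trans mult_dvd_mono)
    moreover have "k2 = p * p * c" "k3 = p * p * (g * g * c)"
      using K K' by (simp_all add: ac_simps)
    ultimately show "r dvd k2" "r dvd k3"
      by (simp_all only: dvd_mult2)
  qed
  have "t dvd k1 + b"
  proof -
    have "t dvd a + b" "t dvd p" "t dvd p * p * c * g"
      using q qpg dvd_trans[OF tq] by (simp_all add: dvd_mult)
    then have "t dvd a + b + p * c + p * p * c * g"
      by (simp add: dvd_mult2)
    then show ?thesis
      using K K' by (simp add: ac_simps)
  qed
  then have k1: "\<not> t dvd k1" "\<not> t dvd 1 + k1"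
    using b dvd_add[of t "k1 + b" k1] dvd_add[of t "k1 + b" "1 + k1"] by (auto simp: ac_simps)
  then obtain l where l: "k1 * l = 1"
    using unitE by blast
  have "det K = 1"
    using KE subSL_D(1)[OF rigidD(2)[OF rig]] by (simp add: SL2_def)
  then have "k1 * k4 = 1 + k2 * k3"
    by (rule_tac move) (simp add: K')
  then have "k1 * (l + k4) = k2 * k3"
    using l by (simp add: distrib_left)
  then have "r dvd l + k4"
    using r k1 by (metis dvd_mult2 unit_cancel)
  then have "dg k1 l \<in> cj P ` E"
    using rigid_eqM[OF rig KE, of "dg k1 l"] l r by (simp add: K' r_def)
  then show ?thesis
    using that P k1 by blast
qed

end

text \<open>A rigid subgroup after the diagonalizing conjugation. The diagonal element has distinct
  eigenvalues modulo \<open>t\<close>, so commutators with it detect off-diagonal entries.\<close>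

locale split_rigid = dvr2 +
  fixes n E w w'
  assumes rig: "rigid n E" and s: "dg w w' \<in> E" and w: "\<not> t dvd 1 + w"
begin

abbreviation "q \<equiv> t ^ n"
abbreviation "r \<equiv> t ^ Suc n"

lemmas sub = subSL_D[OF rigidD(2)[OF rig]]

lemma tq: "t dvd q" and rqq: "r dvd q * q" and qr: "q dvd r"
  using rigidD(1)[OF rig] t_power_dvd_mult[of n q n q "Suc n"]
  by (simp_all add: le_imp_power_dvd del: power_Suc)

lemma ww': "w * w' = 1"
  using sub(1)[OF s] by simp

lemma one_mem:
  assumes "mat2 a b c d \<in> E" "eqM q (mat2 a b c d) (mat 1)"
  shows "r dvd b" "r dvd c"
  using rigidD(4)[OF rig assms] by (auto simp del: power_Suc)

lemma w_unit: "\<not> t dvd 1 + w\<^sup>2" "\<not> t dvd 1 + w'\<^sup>2"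
proof -
  show 1: "\<not> t dvd 1 + w\<^sup>2"
    using w sq_add[of 1 w] by (metis one_power2 t_prime_power2)
  have "w\<^sup>2 * (1 + w'\<^sup>2) = 1 + w\<^sup>2"
    using ww' by (simp add: distrib_left flip: power_mult_distrib)
  then show "\<not> t dvd 1 + w'\<^sup>2"
    using 1 by (metis dvd_mult)
qed

text \<open>The commutator with \<open>dg w w'\<close> lies in \<open>E\<close> and is 1 modulo
  \<open>q\<close>, so its off-diagonal entries are divisible by \<open>r\<close>; they are unit
  multiples of \<open>b\<close> and \<open>c\<close>.\<close>

lemma offdiag:
  assumes M: "mat2 a b c d \<in> E" and q: "q dvd b" "q dvd c"
  shows "r dvd b" "r dvd c"
proof -
  define K where "K = mat2 a b c d ** dg w w' ** adj2 (mat2 a b c d) ** adj2 (dg w w')"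
  have K: "K \<in> E"
    unfolding K_def by (intro sub(3,4) M s)
  have ad: "a * d = 1 + b * c"
    by (rule move) (use sub(1)[OF M] in simp)
  note e = inverse_cancel[OF ww']
  have K': "K = mat2 (a * d + b * c * w'\<^sup>2) (a * (b * (1 + w\<^sup>2))) (d * (c * (1 + w'\<^sup>2))) (a * d + b * c * w\<^sup>2)"
    using ww' unfolding K_def by (simp add: algebra_simps power2_eq_square e)
  have t: "\<not> t dvd a" "\<not> t dvd d"
  proof -
    have "t dvd b * c"
      using dvd_trans[OF tq q(1)] by simp
    then have "\<not> t dvd a * d"
      by (simp add: ad dvd_add_unit)
    then show "\<not> t dvd a" "\<not> t dvd d"
      by auto
  qed
  have "eqM q K (mat 1)"
    using q by (simp add: K' mat2_one ad add.assoc[symmetric] dvd_add)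
  with K have "r dvd a * (b * (1 + w\<^sup>2))" "r dvd d * (c * (1 + w'\<^sup>2))"
    unfolding K' by (rule one_mem)+
  then show "r dvd b" "r dvd c"
    using t w_unit unit_cancel by (metis mult.commute)+
qed

text \<open>An element of \<open>E\<close> close to \<open>dg l l'\<close> is diagonal modulo
  \<open>r\<close> by \<open>offdiag\<close>. Its determinant then forces it to differ from
  \<open>dg l l'\<close> only by a scalar that \<open>E\<close> absorbs.\<close>

lemma dg_mem:
  assumes l: "l * l' = 1"
  shows "dg l l' \<in> E"
proof -
  obtain M where M: "M \<in> E" "eqM q M (dg l l')"
    using rigidD(5)[OF rig, of "dg l l'"] l by auto
  obtain a b c d where M': "M = mat2 a b c d"
    by (metis mat2_cases)
  have q: "q dvd a + l" "q dvd b" "q dvd c" "q dvd d + l'"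
    using M by (simp_all add: M')
  then have r: "r dvd b" "r dvd c"
    using offdiag M M' by blast+
  obtain x y where xy: "a + l = q * x" "d + l' = q * y"
    using q by (auto elim!: dvdE)
  then have a: "a = l + q * x" and d: "d = l' + q * y"
    by (metis move add.commute)+
  have "b * c + a * d = 1"
    using M(1) sub(1) M' by (force simp: add.commute)
  then have "b * c = 1 + (l + q * x) * (l' + q * y)"
    unfolding a d by (rule move)
  then have "q * (l * y + l' * x) + q * q * (x * y) = b * c"
    using l by (simp add: algebra_simps)
  then have "q * (l * y + l' * x) = b * c + q * q * (x * y)"
    by (rule move)
  then have "r dvd q * (l * y + l' * x)"
    using r rqq by (metis dvd_add dvd_mult2)
  then have "r dvd l' * (q * (l * y + l' * x))"
    by (rule dvd_mult)
  moreover have "l' * (q * (l * y + l' * x)) = q * (y + x * l' * l')"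
    using inverse_cancel(1,2)[OF l] by (simp add: algebra_simps)
  ultimately have *: "r dvd q * (y + x * l' * l')"
    by metis
  \<comment> \<open>The scalar is chosen to correct the first diagonal entry; the relation from the
    determinant corrects the second.\<close>
  have "l + (1 + q * (x * l')) * a = q * q * (x * l' * x)"
    by (simp add: a algebra_simps inverse_cancel(1,2)[OF l])
  moreover have "l' + (1 + q * (x * l')) * d = q * (y + x * l' * l') + q * q * (x * l' * y)"
    by (simp add: d algebra_simps)
  ultimately have "eqM r (dg l l') (scal (1 + q * (x * l')) ** M)"
    using r * rqq by (simp add: M' del: power_Suc)
  then show ?thesis
    using rigidD(3)[OF rig M(1)] l by simp
qed

text \<open>Multiply three diagonal conjugates whose upper right entries are scaled by 1,
  \<open>\<beta>\<^sup>2\<close> and \<open>(1 + \<beta>)\<^sup>2\<close>. These sum to zero, so the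
  product is 1 modulo \<open>q\<close>, while its lower left entry is \<open>c\<close> times a unit
  as \<open>\<beta>\<close> is outside the field with four elements.\<close>

lemma lower_left:
  assumes M: "mat2 a b c d \<in> E" and q: "eqM q (mat2 a b c d) (up x)"
  shows "r dvd c"
proof -
  obtain \<beta> where b: "\<not> t dvd \<beta>" "\<not> t dvd 1 + \<beta>" "\<not> t dvd 1 + \<beta> + \<beta>\<^sup>2"
    using ex_scalar by blast
  define \<gamma> where "\<gamma> = 1 + \<beta>"
  obtain \<beta>' \<gamma>' where b': "\<beta> * \<beta>' = 1" and g': "\<gamma> * \<gamma>' = 1"
    using b unitE unfolding \<gamma>_def by metis
  have cjd: "mat2 a (l\<^sup>2 * b) (l'\<^sup>2 * c) d \<in> E" if "l * l' = 1" for l l'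
  proof -
    have "dg l l' ** mat2 a b c d ** dg l' l = mat2 (l * l' * a) (l\<^sup>2 * b) (l'\<^sup>2 * c) (l * l' * d)"
      by (simp add: algebra_simps power2_eq_square)
    then show ?thesis
      using dg_mem[of l l'] dg_mem[of l' l] sub(3) M that by (metis mult.commute mult_1)
  qed
  define F where "F = a * a + d * (\<beta>'\<^sup>2 * a) + (c * (\<beta>\<^sup>2 * b) + d * d) * \<gamma>'\<^sup>2"
  define K where "K = mat2 a b c d ** mat2 a (\<beta>\<^sup>2 * b) (\<beta>'\<^sup>2 * c) d ** mat2 a (\<gamma>\<^sup>2 * b) (\<gamma>'\<^sup>2 * c) d"
  have KE: "K \<in> E"
    unfolding K_def by (intro sub(3) M cjd b' g')
  have q': "q dvd a + 1" "q dvd b + x" "q dvd c" "q dvd d + 1"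
    using q by simp_all
  have "eqM q (mat2 a (l\<^sup>2 * b) (l'\<^sup>2 * c) d) (up (l\<^sup>2 * x))" for l l'
    using q' by (simp flip: distrib_left)
  then have "eqM q K (up x ** up (\<beta>\<^sup>2 * x) ** up (\<gamma>\<^sup>2 * x))"
    unfolding K_def by (intro eqM_mult q)
  moreover have "up x ** up (\<beta>\<^sup>2 * x) ** up (\<gamma>\<^sup>2 * x) = mat 1"
    by (simp add: mat2_one \<gamma>_def sq_add algebra_simps)
  ultimately have "eqM q K (mat 1)"
    by simp
  moreover obtain k1 k2 k4 where K': "K = mat2 k1 k2 (c * F) k4"
    unfolding K_def F_def by (simp add: algebra_simps)
  ultimately have "r dvd c * F"
    using one_mem KE by blast
  moreover have "\<not> t dvd F"
  proof
    assume F: "t dvd F"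
    have t: "t dvd a - 1" "t dvd c - 0" "t dvd d - 1"
      using q' dvd_trans[OF tq] by simp_all
    have "t dvd F - (1 * 1 + 1 * (\<beta>'\<^sup>2 * 1) + (0 * (\<beta>\<^sup>2 * b) + 1 * 1) * \<gamma>'\<^sup>2)"
      unfolding F_def by (intro dvd_diff_add dvd_diff_mult t) simp_all
    then have "t dvd 1 + \<beta>'\<^sup>2 + \<gamma>'\<^sup>2"
      using F by (simp add: dvd_add_right_iff)
    then have "t dvd (\<beta> * \<gamma>)\<^sup>2 * (1 + \<beta>'\<^sup>2 + \<gamma>'\<^sup>2)"
      by (rule dvd_mult)
    \<comment> \<open>Modulo \<open>t\<close>, \<open>F\<close> is the sum of the inverse squares;
      clearing denominators gives the square of
      \<open>1 + \<beta> + \<beta>\<^sup>2\<close>.\<close>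
    also have "(\<beta> * \<gamma>)\<^sup>2 * (1 + \<beta>'\<^sup>2 + \<gamma>'\<^sup>2) = (\<beta> * \<gamma> + \<beta> * \<beta>' * \<gamma> + \<gamma> * \<gamma>' * \<beta>)\<^sup>2"
      by (simp add: sq_add power_mult_distrib algebra_simps)
    also have "\<beta> * \<gamma> + \<beta> * \<beta>' * \<gamma> + \<gamma> * \<gamma>' * \<beta> = 1 + \<beta> + \<beta>\<^sup>2"
      unfolding b' g' by (simp add: \<gamma>_def algebra_simps power2_eq_square)
    finally show False
      using b by simp
  qed
  ultimately show ?thesis
    by (metis mult.commute unit_cancel)
qed

section \<open>The additive group of upper unipotents in \<open>E\<close>, and the bound on the
  level\<close>

lemma up_mem_add: "up x \<in> E \<Longrightarrow> up y \<in> E \<Longrightarrow> up (x + y) \<in> E"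
  using sub(3)[of "up x" "up y"] by (simp add: add.commute)

lemma up_mem_cong:
  assumes "up x \<in> E" "r dvd x + y"
  shows "up y \<in> E"
  using rigid_eqM[OF rig assms(1), of "up y"] assms(2) by (simp add: add.commute)

text \<open>For a unit \<open>l\<close>, conjugate by \<open>dg l l'\<close>; a nonunit is the sum
  of 1 and the unit \<open>1 + l\<close>, and squaring is additive.\<close>

lemma up_mem_square:
  assumes x: "up x \<in> E"
  shows "up (l\<^sup>2 * x) \<in> E"
proof -
  have unit: "up (l\<^sup>2 * x) \<in> E" if l: "\<not> t dvd l" for l
  proof -
    obtain l' where l': "l * l' = 1"
      using unitE[OF l] by blast
    then have "dg l l' ** up x ** dg l' l = up (l\<^sup>2 * x)"
      by (simp add: mult.commute power2_eq_square)
    then show ?thesis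
      using dg_mem[of l l'] dg_mem[of l' l] sub(3) x l' by (metis mult.commute)
  qed
  show ?thesis
  proof (cases "t dvd l")
    case True
    then have "up ((1 + l)\<^sup>2 * x) \<in> E"
      by (intro unit) (simp add: dvd_add_unit)
    from up_mem_add[OF this x] show ?thesis
      by (simp add: sq_add algebra_simps)
  qed (rule unit)
qed

lemma up_mem_small:
  assumes "up x \<in> E" "q dvd x"
  shows "r dvd x"
  using one_mem(1)[OF assms(1)] assms(2) by (simp add: mat2_one)

text \<open>Modulo \<open>r\<close> a lift of \<open>up x\<close> is upper triangular by
  \<open>lower_left\<close>. Scaling by its own entry \<open>a\<close>, which is 1 modulo
  \<open>q\<close>, makes the diagonal trivial since \<open>a * a\<close> and \<open>a * d\<close>
  are 1 modulo \<open>r\<close>.\<close>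

lemma up_mem_approx: "\<exists>y. up y \<in> E \<and> q dvd y + x"
proof -
  obtain M where M: "M \<in> E" "eqM q M (up x)"
    using rigidD(5)[OF rig, of "up x"] by auto
  obtain a b c d where M': "M = mat2 a b c d"
    by (metis mat2_cases)
  have q: "q dvd a + 1" "q dvd b + x" "q dvd c" "q dvd d + 1"
    using M by (simp_all add: M')
  have rc: "r dvd c"
    using lower_left M M' by blast
  obtain z where "a + 1 = q * z"
    using q by (auto elim: dvdE)
  then have a: "a = 1 + q * z"
    by (metis move add.commute)
  have "a * d + b * c = 1"
    using M(1) sub(1) M' by force
  then have ad: "1 + a * d = b * c"
    by (metis move double_right add.commute)
  have "1 + a * a = q * q * (z * z)"
    by (simp add: a algebra_simps)
  then have "eqM r (up (a * b)) (scal (1 + q * z) ** M)"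
    using rc rqq by (simp add: M' ad flip: a del: power_Suc)
  then have "up (a * b) \<in> E"
    using rigidD(3)[OF rig M(1)] by simp
  moreover have "q dvd a * b + x"
  proof -
    have "a * b + x = q * z * b + (b + x)"
      by (simp add: a algebra_simps)
    moreover have "q dvd q * z * b + (b + x)"
      using q by (simp only: dvd_add mult.assoc dvd_triv_left)
    ultimately show ?thesis
      by metis
  qed
  ultimately show ?thesis
    by blast
qed

lemma level_one: "n = 1"
proof (rule ccontr)
  assume "n \<noteq> 1"
  then have n: "n \<ge> 2"
    using rigidD(1)[OF rig] by simp
  show False
  proof (cases "even n")
    case True
    then obtain m where m: "n = m + m"
      by (metis evenE mult_2)
    \<comment> \<open>For even \<open>n\<close>, multiplying a unit by the square \<open>q\<close>
      gives an element of exact valuation \<open>n\<close>, against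
      \<open>up_mem_small\<close>.\<close>
    obtain y where y: "up y \<in> E" "q dvd y + 1"
      using up_mem_approx by blast
    have "(t ^ m)\<^sup>2 = q"
      by (simp add: m power_add power2_eq_square)
    then have "r dvd q * y"
      using up_mem_small[of "q * y"] up_mem_square[OF y(1), of "t ^ m"] by simp
    then have "t dvd y"
      by (simp add: mult.commute[of t])
    moreover have "t dvd y + 1"
      using dvd_trans[OF tq y(2)] .
    ultimately show False
      by (simp add: dvd_add_right_iff)
  next
    case False
    then obtain m where m: "n = m + m + 1"
      by (metis oddE mult_2)
    \<comment> \<open>For odd \<open>n\<close>, start from an element close to \<open>t\<close> and
      multiply by \<open>t ^ (n - 1)\<close>, which is a square.\<close>
    obtain y where y: "up y \<in> E" "q dvd y + t"
      using up_mem_approx by blast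
    obtain z where "y + t = q * z"
      using y by (auto elim: dvdE)
    then have z: "y = t + q * z"
      by (metis move add.commute)
    have "(t ^ m)\<^sup>2 * y = q * (1 + t ^ (m + m) * z)"
      by (simp add: z m power_add power2_eq_square algebra_simps)
    then have "r dvd q * (1 + t ^ (m + m) * z)"
      using up_mem_small[of "q * (1 + t ^ (m + m) * z)"] up_mem_square[OF y(1), of "t ^ m"] by simp
    then have "t dvd 1 + t ^ (m + m) * z"
      by (simp add: mult.commute[of t])
    \<comment> \<open>Here \<open>n \<ge> 2\<close> matters: it gives \<open>m > 0\<close>. At level
      1 the argument stops.\<close>
    moreover have "t dvd t ^ (m + m) * z"
      using n m by (intro dvd_mult2) simp
    ultimately show False
      by (simp add: dvd_add_left_iff)
  qed
qed

end

section \<open>Rigid subgroups at level one\<close>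

abbreviation tr2 :: "'a::comm_ring_1^2^2 \<Rightarrow> 'a" where
  "tr2 A \<equiv> A $ 1 $ 1 + A $ 2 $ 2"

lemma tr2_commute:
  fixes A B :: "'a::comm_ring_1^2^2"
  shows "tr2 (A ** B) = tr2 (B ** A)"
  by (rule mat2_cases[of A], rule mat2_cases[of B]) (simp add: algebra_simps)

lemma tr2_cj: "P \<in> SL2 \<Longrightarrow> tr2 (cj P M) = tr2 M"
  using tr2_commute[of "P ** M" "adj2 P"] by (simp add: cj_def matrix_mul_assoc SL2_inverse)

lemma inverse_adj2:
  fixes f f' :: "'a::comm_ring_1^2^2"
  assumes "f ** f' = mat 1"
  shows "f' = scal (det f') ** adj2 f"
proof -
  have "det f' * det f = 1"
    using assms by (metis det_I det_mul mult.commute)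
  then have "scal (det f') ** (scal (det f) ** f') = f'"
    unfolding scal_mult_scal by (simp add: scal_one)
  also have "scal (det f) ** f' = adj2 f"
    using assms by (metis mult_adj2(2) matrix_mul_assoc matrix_mul_rid)
  finally show ?thesis ..
qed

context split_rigid
begin

lemma swap_mem: "mat2 a b c d \<in> cj (mat2 0 1 1 0) ` E \<longleftrightarrow> mat2 d c b a \<in> E"
proof -
  have cj: "cj (mat2 0 1 1 0) (mat2 a b c d) = mat2 d c b a" for a b c d :: 'a
    by (simp add: cj_def)
  show ?thesis
  proof
    assume "mat2 a b c d \<in> cj (mat2 0 1 1 0) ` E"
    then obtain M where M: "M \<in> E" "mat2 a b c d = cj (mat2 0 1 1 0) M"
      by auto
    then show "mat2 d c b a \<in> E"
      by (cases M rule: mat2_cases) (simp add: cj)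
  next
    assume "mat2 d c b a \<in> E"
    then show "mat2 a b c d \<in> cj (mat2 0 1 1 0) ` E"
      using cj by (metis imageI)
  qed
qed

text \<open>The Weyl element exchanges upper and lower unipotents, so every result above has a
  mirror image.\<close>

lemma swap: "split_rigid t n (cj (mat2 0 1 1 0) ` E) w' w"
proof (unfold_locales)
  show "rigid n (cj (mat2 0 1 1 0) ` E)"
    by (rule rigid_cj[OF rig]) simp
  show "dg w' w \<in> cj (mat2 0 1 1 0) ` E"
    using s by (simp add: swap_mem)
  show "\<not> t dvd 1 + w'"
    using w_unit(2) sq_add[of 1 w'] by (metis one_power2 t_prime_power2)
qed

lemmas lo_mem_cong = split_rigid.up_mem_cong[OF swap, unfolded swap_mem]
lemmas lo_mem_square = split_rigid.up_mem_square[OF swap, unfolded swap_mem]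
lemmas lo_mem_approx = split_rigid.up_mem_approx[OF swap, unfolded swap_mem]

lemma q_eq: "q = t"
  by (simp add: level_one)

text \<open>A matrix antidiagonal modulo \<open>q\<close> inverts \<open>dg w w'\<close> by
  conjugation, so the product \<open>K\<close> without the final inverse is 1 modulo
  \<open>q\<close>; its upper right entry is a unit multiple of \<open>a\<close>.\<close>

lemma antidiag:
  assumes M: "mat2 a b c d \<in> E" and q: "q dvd a" "q dvd d"
  shows "r dvd a"
proof -
  define K where "K = mat2 a b c d ** dg w w' ** adj2 (mat2 a b c d) ** dg w w'"
  have K: "K \<in> E"
    unfolding K_def by (intro sub(3,4) M s)
  have bc: "b * c = 1 + a * d"
    by (rule move) (use sub(1)[OF M] in \<open>simp add: add.commute\<close>)
  note e = inverse_cancel[OF ww']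
  have K': "K = mat2 (b * c + a * d * w\<^sup>2) (b * (a * (1 + w'\<^sup>2))) (c * (d * (1 + w\<^sup>2))) (b * c + a * d * w'\<^sup>2)"
    using ww' unfolding K_def by (simp add: algebra_simps power2_eq_square e)
  have t: "\<not> t dvd b"
  proof -
    have "t dvd a * d"
      using dvd_trans[OF tq q(1)] by simp
    then have "\<not> t dvd b * c"
      by (simp add: bc dvd_add_unit)
    then show "\<not> t dvd b"
      by auto
  qed
  have "eqM q K (mat 1)"
    using q by (simp add: K' mat2_one bc add.assoc[symmetric] dvd_add)
  with K have "r dvd b * (a * (1 + w'\<^sup>2))"
    unfolding K' by (rule one_mem)
  then show "r dvd a"
    using t w_unit(2) by (metis mult.commute unit_cancel)
qed

text \<open>With \<open>y\<close> close to \<open>v'\<close>, the product of \<open>up v\<close>,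
  \<open>lo y\<close> and \<open>up v\<close> is antidiagonal modulo \<open>q\<close>. By
  \<open>antidiag\<close> it is so modulo \<open>r\<close>, which forces \<open>y\<close> to agree
  with \<open>v'\<close> modulo \<open>r\<close>.\<close>

lemma ex_root_pair:
  obtains v v' where "v * v' = 1" "up v \<in> E" "lo v' \<in> E"
proof -
  obtain v where v: "up v \<in> E" "q dvd v + 1"
    using up_mem_approx by blast
  have "\<not> t dvd v"
    using dvd_trans[OF tq v(2)] by (auto simp: dvd_add_right_iff)
  then obtain v' where v': "v * v' = 1"
    using unitE by blast
  obtain y where y: "lo y \<in> E" "q dvd y + v'"
    using lo_mem_approx by blast
  have "v * (y + v') = 1 + v * y"
    using v' by (simp add: distrib_left add.commute)
  then have "q dvd 1 + v * y"
    using y by (metis dvd_mult)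
  moreover have "mat2 (1 + v * y) (v + (1 + v * y) * v) y (1 + v * y) \<in> E"
    using sub(3)[OF sub(3)[OF v(1) y(1)] v(1)] by (simp add: algebra_simps)
  ultimately have "r dvd 1 + v * y"
    using antidiag by blast
  then have "r dvd v' * (1 + v * y)"
    by (rule dvd_mult)
  also have "v' * (1 + v * y) = y + v'"
    using v' by (simp add: distrib_left inverse_cancel add.commute)
  finally have "lo v' \<in> E"
    using lo_mem_cong[OF y(1)] by simp
  then show ?thesis
    using that v' v by blast
qed

text \<open>Up to the diagonal conjugation by \<open>v\<close>, this is the Frobenius of the ring applied
  entrywise; modulo \<open>t\<^sup>2\<close> its image is a copy of the special linear group of the residue field.\<close>

definition frob :: "'a \<Rightarrow> 'a \<Rightarrow> 'a^2^2 \<Rightarrow> 'a^2^2" where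
  "frob v v' M = mat2 ((M$1$1)\<^sup>2) (v * (M$1$2)\<^sup>2) (v' * (M$2$1)\<^sup>2) ((M$2$2)\<^sup>2)"

lemma frob_mat2 [simp]: "frob v v' (mat2 a b c d) = mat2 (a\<^sup>2) (v * b\<^sup>2) (v' * c\<^sup>2) (d\<^sup>2)"
  by (simp add: frob_def)

lemma tr2_frob: "tr2 (frob v v' M) = (tr2 M)\<^sup>2"
  by (simp add: frob_def sq_add)

section \<open>The Frobenius image inside \<open>E\<close> and the normalizer of
  \<open>E\<close>\<close>

context
  fixes v v' :: 'a assumes v': "v * v' = 1"
begin

lemma frob_mult: "frob v v' (A ** B) = frob v v' A ** frob v v' B"
  by (rule mat2_cases[of A], rule mat2_cases[of B])
    (simp add: sq_add power_mult_distrib algebra_simps inverse_cancel[OF v'])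

lemma det_frob: "det (frob v v' M) = (det M)\<^sup>2"
  by (rule mat2_cases[of M]) (simp add: sq_add power_mult_distrib algebra_simps inverse_cancel[OF v'])

lemma frob_mem:
  assumes up: "up v \<in> E" and lo: "lo v' \<in> E" and M: "M \<in> SL2"
  shows "frob v v' M \<in> E"
proof (rule SL2_induct[OF M])
  show "frob v v' (A ** B) \<in> E" if "frob v v' A \<in> E" "frob v v' B \<in> E" for A B
    using that by (simp add: frob_mult sub)
  show "frob v v' (up x) \<in> E" for x
    using up_mem_square[OF up, of x] by (simp add: mult.commute)
  show "frob v v' (lo x) \<in> E" for x
    using lo_mem_square[OF lo, of x] by (simp add: mult.commute)
qed

text \<open>Take square roots of the entries in the perfect residue field, after removing the twist
  by \<open>v\<close>. The determinant of the root matrix has square 1 modulo \<open>t\<close>, so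
  it is 1 there and \<open>SL2_lift\<close> applies.\<close>

lemma frob_lift:
  assumes A: "t dvd det A + 1"
  obtains M where "M \<in> SL2" "eqM t A (frob v v' M)"
proof -
  obtain x y z u where A': "A = mat2 x y z u"
    by (metis mat2_cases)
  obtain a b c d where sq: "t dvd x - a\<^sup>2" "t dvd v' * y - b\<^sup>2" "t dvd v * z - c\<^sup>2" "t dvd u - d\<^sup>2"
    using perfect by metis
  have "t dvd v * (v' * y - b\<^sup>2)" "t dvd v' * (v * z - c\<^sup>2)"
    using sq by (simp_all only: dvd_mult)
  then have eq: "eqM t A (frob v v' (mat2 a b c d))"
    using sq by (simp add: A' distrib_left inverse_cancel[OF v'])
  have "t dvd (det A + 1) + (det A - det (frob v v' (mat2 a b c d)))"
    using A eqM_det[OF eq] by (rule dvd_add)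
  also have "(det A + 1) + (det A - det (frob v v' (mat2 a b c d))) = (det (mat2 a b c d) + 1)\<^sup>2"
    unfolding det_frob by (simp add: sq_add add.commute)
  finally have "t dvd det (mat2 a b c d) - 1"
    by simp
  then obtain M where M: "M \<in> SL2" "eqM t M (mat2 a b c d)"
    using SL2_lift by blast
  then have "eqM t (frob v v' M) (frob v v' (mat2 a b c d))"
    by (cases M rule: mat2_cases) (simp flip: distrib_left sq_add)
  then show ?thesis
    using that M eq by (meson eqM_sym eqM_trans)
qed

text \<open>Commutators of \<open>f\<close> with elements of \<open>E\<close> lie in
  \<open>E\<close> and are 1 modulo \<open>q\<close>. The one with \<open>dg w w'\<close> kills the
  off-diagonal entries modulo \<open>r\<close>, the one with \<open>up v\<close> the difference of
  the diagonal entries.\<close>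

lemma normalizing_scalar:
  assumes inv: "f ** f' = mat 1" and nrm: "\<And>M. M \<in> E \<Longrightarrow> f ** M ** f' \<in> E"
    and f: "eqM q f (scal m)" and up: "up v \<in> E"
  shows "\<exists>l. eqM r f (scal l)"
proof -
  obtain a b c d where f': "f = mat2 a b c d"
    by (metis mat2_cases)
  have q: "q dvd b" "q dvd c"
    using f by (simp_all add: f')
  have "q dvd a - m" "q dvd m - d"
    using f by (simp_all add: f' add.commute)
  from dvd_diff_trans[OF this] have ad: "q dvd a + d"
    by simp
  define e where "e = det f'"
  have e: "e * (a * d + b * c) = 1"
  proof -
    have "det f' * det f = 1"
      using inv by (metis det_I det_mul mult.commute)
    then show ?thesis
      by (simp add: e_def f')
  qed
  have inv': "f' = scal e ** mat2 d b c a"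
    using inverse_adj2[OF inv] by (simp add: e_def f')
  have ead: "e * a * d = 1 + e * b * c"
    by (rule move) (use e in \<open>simp add: algebra_simps\<close>)
  have "t dvd e * b * c"
    using dvd_trans[OF tq q(1)] by simp
  then have "\<not> t dvd e * a * d"
    by (simp add: ead dvd_add_unit)
  then have t: "\<not> t dvd e * a" "\<not> t dvd e * d"
    by (auto simp: t_prime)
  note ew = inverse_cancel[OF ww']
  define K where "K = f ** dg w w' ** f' ** adj2 (dg w w')"
  have K: "K \<in> E"
    unfolding K_def by (intro sub(3,4) nrm s)
  have K': "K = mat2 (e * a * d + e * b * c * w'\<^sup>2) (e * a * (b * (1 + w\<^sup>2)))
      (e * d * (c * (1 + w'\<^sup>2))) (e * a * d + e * b * c * w\<^sup>2)"
    using ww' unfolding K_def f' inv' by (simp add: algebra_simps power2_eq_square ew)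
  have "eqM q K (mat 1)"
    using q by (simp add: K' mat2_one ead add.assoc[symmetric] dvd_add)
  with K have "r dvd e * a * (b * (1 + w\<^sup>2))" "r dvd e * d * (c * (1 + w'\<^sup>2))"
    unfolding K' by (rule one_mem)+
  then have r: "r dvd b" "r dvd c"
    using t w_unit by (metis unit_cancel mult.commute)+
  \<comment> \<open>A commutator, since \<open>up v\<close> is its own inverse in characteristic
    2.\<close>
  define L where "L = f ** up v ** f' ** up v"
  have L: "L \<in> E"
    unfolding L_def by (intro sub(3,4) nrm up)
  have L': "L = mat2 (e * (a * d + b * c) + e * a * v * c) (e * (a * d + b * c) * v + e * a * v * c * v + e * a * a * v)
      (e * v * c * c) (e * (a * d + b * c) + e * a * v * c + e * v * c * c * v)"
    unfolding L_def f' inv' by (simp add: algebra_simps)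
  have *: "v + e * a * v * c * v + e * a * a * v = e * a * v * v * c + (e * b * v) * c + e * a * (a + d) * v"
  proof -
    have "v = e * (a * d + b * c) * v"
      by (simp add: e)
    then have "v + e * a * v * c * v + e * a * a * v =
        e * (a * d + b * c) * v + e * a * v * c * v + e * a * a * v"
      by presburger
    then show ?thesis
      by (simp add: algebra_simps)
  qed
  have "eqM q L (mat 1)"
    using q ad unfolding L' e mult_1 by (simp add: mat2_one *)
  with L have "r dvd e * a * v * v * c + (e * b * v) * c + e * a * (a + d) * v"
    unfolding L' e mult_1 * by (rule one_mem)
  moreover have "r dvd e * a * v * v * c + (e * b * v) * c"
    using r by (simp del: power_Suc)
  ultimately have "r dvd e * a * (a + d) * v"
    by (metis dvd_add_right_iff)
  then have "r dvd e * a * (a + d) * v * v'"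
    by (rule dvd_mult2)
  also have "e * a * (a + d) * v * v' = e * a * (a + d)"
    using v' by (simp add: mult.assoc)
  finally have "r dvd a + d"
    using t unit_cancel by blast
  then have "eqM r f (scal a)"
    using r by (simp add: f' add.commute del: power_Suc)
  then show ?thesis ..
qed

text \<open>A square root of \<open>det h\<close> modulo \<open>t\<close> scales \<open>h\<close> to
  determinant 1, so \<open>h\<close> is a scalar times some \<open>frob v v' M\<close> modulo
  \<open>t\<close>. Dividing by that element of \<open>E\<close> leaves a normalizing matrix that is
  scalar modulo \<open>q\<close>.\<close>

lemma normalizing_shape:
  assumes inv: "h ** h' = mat 1" and nrm: "\<And>M. M \<in> E \<Longrightarrow> h ** M ** h' \<in> E"
    and up: "up v \<in> E" and lo: "lo v' \<in> E"
  shows "\<exists>l. \<exists>M\<in>SL2. eqM r h (scal l ** frob v v' M)"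
proof -
  have "det h * det h' = 1"
    using inv by (metis det_I det_mul)
  then have h: "\<not> t dvd det h"
    by (metis dvd_mult2 t_nonunit)
  obtain m where m: "t dvd det h - m\<^sup>2"
    using perfect by blast
  then have "\<not> t dvd m"
    using h by (metis diff_add dvd_add_left_iff t_prime_power2)
  then obtain m' where m': "m * m' = 1"
    using unitE by blast
  have "t dvd m'\<^sup>2 * (det h - m\<^sup>2)"
    using m by (rule dvd_mult)
  also have "m'\<^sup>2 * (det h - m\<^sup>2) = det (scal m' ** h) + 1"
    unfolding det_scal_mult using m'
    by (simp add: distrib_left mult.commute flip: power_mult_distrib)
  finally obtain M where M: "M \<in> SL2" "eqM t (scal m' ** h) (frob v v' M)"
    using frob_lift by blast
  define F where "F = frob v v' M"
  have F: "F \<in> E" "F \<in> SL2"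
    using frob_mem up lo M sub by (auto simp: F_def)
  define f where "f = h ** adj2 F"
  define f' where "f' = F ** h'"
  have "h = scal m ** (scal m' ** h)"
    unfolding scal_mult_scal by (simp add: m' scal_one)
  then have "eqM t h (scal m ** F)"
    using M eqM_mult[of t "scal m" "scal m"] by (metis F_def eqM_refl)
  then have "eqM t f (scal m ** F ** adj2 F)"
    unfolding f_def by (rule eqM_mult) simp
  then have "eqM q f (scal m)"
    using F by (simp add: q_eq SL2_inverse flip: matrix_mul_assoc)
  moreover have "f ** f' = mat 1"
    using F inv by (metis SL2_inverse(2) f'_def f_def matrix_mul_assoc matrix_mul_rid)
  moreover have "f ** N ** f' \<in> E" if "N \<in> E" for N
  proof -
    have "h ** (adj2 F ** N ** F) ** h' \<in> E"
      by (intro nrm sub(3,4) F that)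
    then show ?thesis
      by (simp add: f_def f'_def matrix_mul_assoc)
  qed
  ultimately obtain l where "eqM r f (scal l)"
    using normalizing_scalar up by blast
  then have "eqM r (f ** F) (scal l ** F)"
    by (rule eqM_mult) simp
  moreover have "f ** F = h"
    using F by (simp add: f_def SL2_inverse flip: matrix_mul_assoc)
  ultimately show ?thesis
    using M F_def by auto
qed

end

end

context dvr2
begin

text \<open>\<open>\<Phi>\<close> is the twisted Frobenius transported back through the
  diagonalizing conjugation, which the trace and the normalizer condition do not see.\<close>

lemma rigid_normalizer:
  assumes E: "rigid n E"
  obtains \<Phi> where "n = 1" "\<And>A B. \<Phi> (A ** B) = \<Phi> A ** \<Phi> B"
    "\<And>M. M \<in> SL2 \<Longrightarrow> \<Phi> M \<in> SL2" "\<And>M. tr2 (\<Phi> M) = (tr2 M)\<^sup>2"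
    "\<And>h h'. h ** h' = mat 1 \<Longrightarrow> (\<And>M. M \<in> E \<Longrightarrow> h ** M ** h' \<in> E) \<Longrightarrow>
      \<exists>l. \<exists>M\<in>SL2. eqM (t\<^sup>2) h (scal l ** \<Phi> M)"
proof -
  obtain P w w' where P: "P \<in> SL2" and w: "dg w w' \<in> cj P ` E" "\<not> t dvd 1 + w"
    using rigid_diagonalize[OF E] .
  interpret split_rigid t n "cj P ` E" w w'
    by unfold_locales (use rigid_cj[OF E P] w in auto)
  obtain v v' where v: "v * v' = 1" "up v \<in> cj P ` E" "lo v' \<in> cj P ` E"
    using ex_root_pair .
  define \<Phi> where "\<Phi> M = cj (adj2 P) (frob v v' M)" for M
  have P': "adj2 P \<in> SL2"
    using P by (rule SL2_adj2)
  show ?thesis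
  proof (rule that)
    show "n = 1"
      by (rule level_one)
    show "\<Phi> (A ** B) = \<Phi> A ** \<Phi> B" for A B
      using P' v by (simp add: \<Phi>_def frob_mult cj_mult)
    show "\<Phi> M \<in> SL2" if "M \<in> SL2" for M
    proof -
      have "frob v v' M \<in> SL2"
        using that v by (simp add: SL2_def det_frob)
      then show ?thesis
        unfolding \<Phi>_def using P' cj_SL2 by blast
    qed
    show "tr2 (\<Phi> M) = (tr2 M)\<^sup>2" for M
      using tr2_cj[OF P', of "frob v v' M"] tr2_frob[of v v' M] by (simp add: \<Phi>_def)
    fix h h' :: "'a^2^2"
    assume h: "h ** h' = mat 1" "\<And>M. M \<in> E \<Longrightarrow> h ** M ** h' \<in> E"
    have "cj P h ** cj P h' = mat 1"
      using h P by (simp add: cj_one flip: cj_mult)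
    moreover have "cj P h ** M ** cj P h' \<in> cj P ` E" if "M \<in> cj P ` E" for M
      using that h P by (auto simp flip: cj_mult)
    ultimately obtain l M where M: "M \<in> SL2" "eqM r (cj P h) (scal l ** frob v v' M)"
      using normalizing_shape[OF v(1) _ _ v(2,3)] by metis
    from eqM_cj[OF M(2), of "adj2 P"] have "eqM (t\<^sup>2) h (scal l ** \<Phi> M)"
      using P P' by (simp add: cj_inverse \<Phi>_def cj_scal_mult level_one power2_eq_square)
    then show "\<exists>l. \<exists>M\<in>SL2. eqM (t\<^sup>2) h (scal l ** \<Phi> M)"
      using M by blast
  qed
qed

end

section \<open>Subgroups with large reductions\<close>

lemma scal_mult_mult:
  fixes A B :: "'a::comm_ring_1^2^2"
  shows "scal c ** A ** (scal d ** B) = scal (c * d) ** (A ** B)"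
  by (rule mat2_cases[of A], rule mat2_cases[of B]) (simp add: algebra_simps)

lemma mat2_add [simp]:
  "mat2 a b c d + mat2 a' b' c' d' = mat2 (a + a') (b + b') (c + c') (d + d')"
  by (rule mat2_eqI) simp_all

lemma cj_add:
  fixes P A B :: "'a::comm_ring_1^2^2"
  shows "cj P (A + B) = cj P A + cj P B"
  by (rule mat2_cases[of P], rule mat2_cases[of A], rule mat2_cases[of B])
    (simp add: cj_def algebra_simps)

lemma eqM_add:
  fixes A B C D :: "'a::comm_ring_1^2^2"
  shows "eqM m A B \<Longrightarrow> eqM m C D \<Longrightarrow> eqM m (A + C) (B + D)"
  by (simp add: eqM_def dvd_diff_add)

lemma eqM_scal_mult: "eqM m A B \<Longrightarrow> eqM (c * m) (scal c ** A) (scal c ** B)"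
  by (rule mat2_cases[of A], rule mat2_cases[of B])
    (simp add: mult_dvd_mono flip: right_diff_distrib)

context dvr2
begin

definition surj_mod :: "nat \<Rightarrow> ('a^2^2) set \<Rightarrow> bool" where
  "surj_mod n D \<longleftrightarrow> (\<forall>M\<in>SL2. \<exists>g\<in>D. eqM (t ^ n) g M)"

text \<open>The determinant of \<open>1 + t ^ n X\<close> is 1 plus \<open>t ^ n\<close> times the
  trace of \<open>X\<close>, up to a multiple of \<open>t ^ (2 * n)\<close>.\<close>

lemma congruence_one:
  assumes n: "0 < n" and K: "K \<in> SL2" and q: "eqM (t ^ n) K (mat 1)"
  obtains X where "K = mat 1 + scal (t ^ n) ** X" "t dvd tr2 X"
proof -
  obtain a b c d where K': "K = mat2 a b c d"
    by (metis mat2_cases)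
  obtain x y z u where *: "a + 1 = t ^ n * x" "b = t ^ n * y" "c = t ^ n * z" "d + 1 = t ^ n * u"
    using q by (auto simp: K' mat2_one elim!: dvdE)
  then have ad: "a = 1 + t ^ n * x" "d = 1 + t ^ n * u"
    by (metis move add.commute)+
  have "a * d + b * c = 1"
    using K by (simp add: K')
  then have "t ^ n * (x + u) + t ^ n * (t ^ n * (x * u + y * z)) = 0"
    unfolding ad *(2,3) by (simp add: algebra_simps)
  then have "t ^ n * ((x + u) + t ^ n * (x * u + y * z)) = 0"
    by (simp add: distrib_left)
  then have "(x + u) + t ^ n * (x * u + y * z) = 0"
    by simp
  then have "x + u = t ^ n * (x * u + y * z)"
    by (metis move add_0)
  then have "t dvd x + u"
    using n by (metis dvd_mult2 t_dvd_power)
  then have "t dvd tr2 (mat2 x y z u)"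
    by simp
  moreover have "K = mat 1 + scal (t ^ n) ** mat2 x y z u"
    by (simp add: K' ad * mat2_one)
  ultimately show ?thesis
    using that by blast
qed

text \<open>The scalars \<open>1 + t ^ n * z\<close> are central and closed under products. Trace
  zero in characteristic 2 makes the diagonal entries of a layer element agree, so vanishing
  off-diagonal entries make it scalar.\<close>

lemma rigid_saturation:
  assumes n: "0 < n" and D: "subSL D" and surj: "surj_mod n D"
    and offdiag: "\<And>g. g \<in> D \<Longrightarrow> eqM (t ^ n) g (mat 1) \<Longrightarrow> t ^ Suc n dvd g$1$2 \<and> t ^ Suc n dvd g$2$1"
  shows "rigid n {N \<in> SL2. \<exists>g\<in>D. \<exists>z. eqM (t ^ Suc n) N (scal (1 + t ^ n * z) ** g)}" (is "rigid n ?E")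
proof -
  define q where "q = t ^ n"
  define r where "r = t ^ Suc n"
  have qr: "q dvd r"
    by (simp add: q_def r_def)
  have one: "(1 + q * z) * (1 + q * z') = 1 + q * (z + z' + q * z * z')" for z z'
    by (simp add: algebra_simps)
  note sub = subSL_D[OF D]
  have DE: "D \<subseteq> ?E"
  proof
    fix g assume "g \<in> D"
    moreover have "eqM (t ^ Suc n) g (scal (1 + t ^ n * 0) ** g)"
      by (simp add: scal_one)
    ultimately show "g \<in> ?E"
      using sub(1) by blast
  qed
  show ?thesis
    unfolding rigid_def q_def[symmetric] r_def[symmetric]
  proof (intro conjI ballI allI impI n)
    show "subSL {N \<in> SL2. \<exists>g\<in>D. \<exists>z. eqM r N (scal (1 + q * z) ** g)}"
      unfolding subSL_def
    proof (intro conjI ballI)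
      show "mat 1 \<in> {N \<in> SL2. \<exists>g\<in>D. \<exists>z. eqM r N (scal (1 + q * z) ** g)}"
        using subsetD[OF DE sub(2)] by (simp add: q_def r_def)
      fix A
      assume "A \<in> {N \<in> SL2. \<exists>g\<in>D. \<exists>z. eqM r N (scal (1 + q * z) ** g)}"
      then obtain g z where A: "A \<in> SL2" "g \<in> D" "eqM r A (scal (1 + q * z) ** g)"
        by blast
      show "adj2 A \<in> {N \<in> SL2. \<exists>g\<in>D. \<exists>z. eqM r N (scal (1 + q * z) ** g)}"
        using A eqM_adj2[OF A(3)] sub(4) by (auto simp: adj2_scal_mult SL2_adj2)
      fix B
      assume "B \<in> {N \<in> SL2. \<exists>g\<in>D. \<exists>z. eqM r N (scal (1 + q * z) ** g)}"
      then obtain g' z' where B: "B \<in> SL2" "g' \<in> D" "eqM r B (scal (1 + q * z') ** g')"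
        by blast
      have "scal (1 + q * z) ** g ** (scal (1 + q * z') ** g') = scal ((1 + q * z) * (1 + q * z')) ** (g ** g')"
        by (rule scal_mult_mult)
      then have "eqM r (A ** B) (scal (1 + q * (z + z' + q * z * z')) ** (g ** g'))"
        unfolding one[symmetric] using eqM_mult[OF A(3) B(3)] by simp
      then show "A ** B \<in> {N \<in> SL2. \<exists>g\<in>D. \<exists>z. eqM r N (scal (1 + q * z) ** g)}"
        using SL2_mult[OF A(1) B(1)] sub(3)[OF A(2) B(2)] by blast
    qed auto
  next
    fix M N z
    assume "M \<in> {N \<in> SL2. \<exists>g\<in>D. \<exists>z. eqM r N (scal (1 + q * z) ** g)}"
      and N: "N \<in> SL2" "eqM r N (scal (1 + q * z) ** M)"
    then obtain g z' where M: "g \<in> D" "eqM r M (scal (1 + q * z') ** g)"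
      by blast
    have "eqM r (scal (1 + q * z) ** M) (scal (1 + q * z) ** (scal (1 + q * z') ** g))"
      using M(2) by (intro eqM_mult) auto
    then have "eqM r N (scal (1 + q * (z + z' + q * z * z')) ** g)"
      using N eqM_trans unfolding scal_mult_scal one by blast
    then show "N \<in> {N \<in> SL2. \<exists>g\<in>D. \<exists>z. eqM r N (scal (1 + q * z) ** g)}"
      using N M by blast
  next
    fix M
    assume "M \<in> {N \<in> SL2. \<exists>g\<in>D. \<exists>z. eqM r N (scal (1 + q * z) ** g)}" and M1: "eqM q M (mat 1)"
    then obtain g z where M: "g \<in> D" "eqM r M (scal (1 + q * z) ** g)"
      by blast
    have "eqM q (scal (1 + q * z) ** g) (scal 1 ** g)"
      by (rule eqM_scal) simp
    then have "eqM q g (scal (1 + q * z) ** g)"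
      by (simp add: scal_one eqM_sym)
    also have "eqM q \<dots> M"
      using M(2) qr eqM_dvd eqM_sym by blast
    also note M1
    finally have g1: "eqM q g (mat 1)" .
    then obtain X where X: "g = mat 1 + scal q ** X" "t dvd tr2 X"
      using congruence_one[OF n] M(1) sub(1) unfolding q_def by metis
    obtain a b c d where X': "X = mat2 a b c d"
      by (metis mat2_cases)
    have "r dvd q * (a + d)"
      using X(2) by (simp add: X' q_def r_def mult.commute[of t])
    moreover have "r dvd g$1$2 \<and> r dvd g$2$1"
      using offdiag[OF M(1)] g1 by (simp add: q_def r_def)
    ultimately have "eqM r g (scal (1 + q * a))"
      by (simp add: X(1) X' mat2_one distrib_left add.commute)
    then have "eqM r (scal (1 + q * z) ** g) (scal (1 + q * z) ** scal (1 + q * a))"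
      by (intro eqM_mult) auto
    then have "eqM r M (scal ((1 + q * z) * (1 + q * a)))"
      using eqM_trans[OF M(2)] by simp
    then show "\<exists>c. eqM r M (scal c)" ..
  next
    fix N :: "'a^2^2"
    assume "N \<in> SL2"
    then show "\<exists>M\<in>{N \<in> SL2. \<exists>g\<in>D. \<exists>z. eqM r N (scal (1 + q * z) ** g)}. eqM q M N"
      using surj DE unfolding surj_mod_def q_def r_def by blast
  qed
qed

lemma saturation_normalized:
  assumes h: "h ** h' = mat 1" and nrm: "\<And>g. g \<in> D \<Longrightarrow> h ** g ** h' \<in> D"
    and N: "N \<in> {N \<in> SL2. \<exists>g\<in>D. \<exists>z. eqM r N (scal (1 + q * z) ** g)}"
  shows "h ** N ** h' \<in> {N \<in> SL2. \<exists>g\<in>D. \<exists>z. eqM r N (scal (1 + q * z) ** g)}"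
proof -
  obtain g z where g: "N \<in> SL2" "g \<in> D" "eqM r N (scal (1 + q * z) ** g)"
    using N by blast
  have "det h * det h' = 1"
    using h by (metis det_I det_mul)
  then have "h ** N ** h' \<in> SL2"
    using g by (simp add: SL2_def det_mul)
  moreover have "eqM r (h ** N ** h') (h ** (scal (1 + q * z) ** g) ** h')"
    using g(3) by (intro eqM_mult) auto
  moreover have "h ** (scal (1 + q * z) ** g) ** h' = scal (1 + q * z) ** (h ** g ** h')"
    by (simp only: matrix_mul_assoc scal_commute[of _ h])
  ultimately show ?thesis
    using g nrm by auto
qed

text \<open>The layer \<open>W\<close> is stable under addition and conjugation, because a product of two
  matrices in the \<open>n\<close>-th congruence subgroup is additive modulo \<open>t ^ (2 * n)\<close>.\<close>

lemma surj_mod_Suc: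
  assumes n: "0 < n" and D: "subSL D" and surj: "surj_mod n D"
    and g: "g \<in> D" "eqM (t ^ n) g (mat 1)" "\<not> (t ^ Suc n dvd g$1$2 \<and> t ^ Suc n dvd g$2$1)"
  shows "surj_mod (Suc n) D"
proof -
  define q where "q = t ^ n"
  define r where "r = t ^ Suc n"
  have qt: "r = q * t"
    by (simp add: q_def r_def mult.commute)
  have rqq: "r dvd q * q"
    using t_power_dvd_mult[of n q n q "Suc n"] n by (simp add: q_def r_def del: power_Suc)
  note sub = subSL_D[OF D]
  define W where "W X \<longleftrightarrow> (\<exists>g\<in>D. eqM r g (mat 1 + scal q ** X))" for X
  have W_cong: "W Y" if "W X" "eqM t X Y" for X Y
  proof -
    obtain g where "g \<in> D" "eqM r g (mat 1 + scal q ** X)"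
      using \<open>W X\<close> W_def by blast
    moreover have "eqM r (mat 1 + scal q ** X) (mat 1 + scal q ** Y)"
      unfolding qt using that by (intro eqM_add eqM_scal_mult) auto
    ultimately show ?thesis
      unfolding W_def using eqM_trans by blast
  qed
  have W_add: "W (X + Y)" if XY: "W X" "W Y" for X Y
  proof -
    obtain g g' where g: "g \<in> D" "eqM r g (mat 1 + scal q ** X)" "g' \<in> D" "eqM r g' (mat 1 + scal q ** Y)"
      using XY unfolding W_def by blast
    have "eqM r (g ** g') ((mat 1 + scal q ** X) ** (mat 1 + scal q ** Y))"
      using g by (intro eqM_mult)
    also have "eqM r \<dots> (mat 1 + scal q ** (X + Y))"
    proof (cases X rule: mat2_cases, cases Y rule: mat2_cases)
      fix a b c d a' b' c' d'
      assume XY: "X = mat2 a b c d" "Y = mat2 a' b' c' d'"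
      have "r dvd q * q * (a * a' + b * c')" "r dvd q * q * (a * b' + b * d')"
        "r dvd q * q * (c * a' + d * c')" "r dvd q * q * (c * b' + d * d')"
        using rqq by simp_all
      then show ?thesis
        by (simp add: XY mat2_one algebra_simps)
    qed
    finally show ?thesis
      unfolding W_def using sub(3)[OF g(1,3)] by blast
  qed
  have W_cj: "W (cj P X)" if X: "W X" and P: "P \<in> SL2" for P X
  proof -
    obtain g where g: "g \<in> D" "eqM r g (mat 1 + scal q ** X)"
      using X W_def by blast
    obtain p where p: "p \<in> D" "eqM q p P"
      using surj P unfolding surj_mod_def q_def by blast
    have p': "p \<in> SL2"
      using p(1) by (rule sub(1))
    have "cj p g \<in> D"
      unfolding cj_def by (intro sub(3,4) p(1) g(1))
    then have "W (cj p X)"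
      unfolding W_def using p' eqM_cj[OF g(2), of p] by (auto simp: cj_add cj_scal_mult cj_one)
    \<comment> \<open>\<open>p\<close> approximates \<open>P\<close> only modulo \<open>q\<close>,
      but the layer depends on \<open>X\<close> modulo \<open>t\<close> alone.\<close>
    moreover have "eqM t (cj p X) (cj P X)"
    proof -
      have "eqM t p P"
        using eqM_dvd[OF p(2)] n by (simp add: q_def)
      then show ?thesis
        unfolding cj_def by (intro eqM_mult eqM_adj2) auto
    qed
    ultimately show ?thesis
      by (rule W_cong)
  qed
  have swap: "W (mat2 d c b a)" if "W (mat2 a b c d)" for a b c d
    using W_cj[OF that, of "mat2 0 1 1 0"] by (simp add: cj_def)
  have diag: "W (mat2 a (l\<^sup>2 * b) (l'\<^sup>2 * c) d)" if "W (mat2 a b c d)" "l * l' = 1" for a b c d l l'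
  proof -
    have "cj (dg l l') (mat2 a b c d) = mat2 (l * l' * a) (l\<^sup>2 * b) (l'\<^sup>2 * c) (l * l' * d)"
      by (simp add: cj_def power2_eq_square ac_simps)
    then show ?thesis
      using W_cj[OF that(1), of "dg l l'"] that(2) by simp
  qed
  have "\<exists>a b c d. W (mat2 a b c d) \<and> t dvd a + d \<and> \<not> t dvd c"
  proof -
    obtain X where X: "g = mat 1 + scal q ** X" "t dvd tr2 X"
      using congruence_one[OF n _ g(2)] sub(1)[OF g(1)] unfolding q_def by metis
    obtain a b c d where X': "X = mat2 a b c d"
      by (metis mat2_cases)
    have WX: "W (mat2 a b c d)"
      unfolding W_def X'[symmetric] X(1)[symmetric] using g(1) eqM_refl by blast
    have "\<not> (t dvd b \<and> t dvd c)"
      using g(3) by (auto simp: X(1) X' mat2_one q_def mult.commute[of t])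
    then show ?thesis
      using X(2) WX swap[OF WX] by (metis X' mat2_nth(1,4) add.commute)
  qed
  then obtain a b c d where W: "W (mat2 a b c d)" and t: "t dvd a + d" "\<not> t dvd c"
    by blast
  \<comment> \<open>Adding the conjugate by \<open>up 1\<close> clears the lower left entry and
    leaves a unit above the diagonal.\<close>
  have "cj (up 1) (mat2 a b c d) + mat2 a b c d = mat2 c (a + d + c) 0 c"
    by (simp add: cj_def algebra_simps)
  then have W1: "W (mat2 c (a + d + c) 0 c)"
    using W_add[OF W_cj[OF W, of "up 1"] W] by simp
  obtain l where l: "\<not> t dvd l" "\<not> t dvd 1 + l"
    using ex_scalar by blast
  then obtain l' where l': "l * l' = 1"
    using unitE by blast
  \<comment> \<open>What remains above the diagonal after adding the conjugate by
    \<open>dg l l'\<close>; the equal diagonals cancel.\<close>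
  define y where "y = (1 + l)\<^sup>2 * (a + d + c)"
  have y: "\<not> t dvd y"
    using l t by (simp add: y_def t_prime dvd_add_right_iff)
  have "W (mat2 0 y 0 0)"
    using W_add[OF diag[OF W1 l'] W1] by (simp add: y_def sq_add algebra_simps)
  then have Wy: "W (mat2 0 (l\<^sup>2 * y) 0 0)" if "\<not> t dvd l" for l
    using diag[of 0 y 0 0 l] unitE[OF that] by (metis mult_zero_right)
  have Wb: "W (mat2 0 x 0 0)" for x
  proof -
    obtain y' where y': "y * y' = 1"
      using y unitE by blast
    \<comment> \<open>As the residue field is perfect, square multiples of the unit \<open>y\<close>
      reach every residue class.\<close>
    obtain k where k: "t dvd y' * x - k\<^sup>2"
      using perfect by blast
    have "t dvd y * (y' * x - k\<^sup>2)"
      using k by (rule dvd_mult)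
    also have "y * (y' * x - k\<^sup>2) = k\<^sup>2 * y + x"
      by (simp add: distrib_left inverse_cancel(1)[OF y'] mult.commute[of y "k\<^sup>2"] add.commute)
    finally have eq: "eqM t (mat2 0 (k\<^sup>2 * y) 0 0) (mat2 0 x 0 0)"
      by simp
    have "W (mat2 0 (k\<^sup>2 * y) 0 0)"
    proof (cases "t dvd k")
      case True
      then have "W (mat2 0 ((1 + k)\<^sup>2 * y) 0 0)"
        by (intro Wy) (simp add: dvd_add_left_iff)
      from W_add[OF this Wy[of 1]] show ?thesis
        by (simp add: sq_add algebra_simps)
    qed (rule Wy)
    then show ?thesis
      using eq by (rule W_cong)
  qed
  have Wd: "W (scal x)" for x
  proof -
    \<comment> \<open>The conjugate by \<open>lo 1\<close> has all four entries equal to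
      \<open>x\<close>; removing the off-diagonal ones leaves a scalar.\<close>
    have "cj (lo 1) (mat2 0 x 0 0) + (mat2 0 x 0 0 + mat2 0 0 x 0) = scal x"
      by (simp add: cj_def)
    then show ?thesis
      using W_add[OF W_cj[OF Wb, of "lo 1"] W_add[OF Wb swap[OF Wb]]] by (metis SL2_mat2 diff_zero mult_1 mult_zero_left)
  qed
  have W_all: "W X" if "t dvd tr2 X" for X
  proof (rule W_cong)
    obtain a b c d where X: "X = mat2 a b c d"
      by (metis mat2_cases)
    show "W (scal (X$1$1) + (mat2 0 (X$1$2) 0 0 + mat2 0 0 (X$2$1) 0))"
      by (intro W_add Wd Wb swap[OF Wb])
    show "eqM t (scal (X$1$1) + (mat2 0 (X$1$2) 0 0 + mat2 0 0 (X$2$1) 0)) X"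
      using that by (simp add: X)
  qed
  show ?thesis
    unfolding surj_mod_def r_def[symmetric]
  proof
    fix N :: "'a^2^2"
    assume N: "N \<in> SL2"
    obtain p where p: "p \<in> D" "eqM q p N"
      using surj N unfolding surj_mod_def q_def by blast
    have p': "p \<in> SL2"
      using p(1) by (rule sub(1))
    \<comment> \<open>The error of the approximation \<open>p\<close> lies in the next layer, so an
      element of \<open>D\<close> corrects it.\<close>
    have "eqM q (N ** adj2 p) (p ** adj2 p)"
      using p(2) by (intro eqM_mult eqM_sym[OF p(2)]) auto
    then have "eqM q (N ** adj2 p) (mat 1)"
      by (simp add: SL2_inverse p')
    then obtain X where X: "N ** adj2 p = mat 1 + scal q ** X" "t dvd tr2 X"
      using congruence_one[OF n, of "N ** adj2 p"] N p' unfolding q_def by (metis SL2_adj2 SL2_mult)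
    then obtain g where g: "g \<in> D" "eqM r g (N ** adj2 p)"
      using W_all W_def by auto
    have "eqM r (g ** p) (N ** adj2 p ** p)"
      using g(2) by (rule eqM_mult) simp
    then have "eqM r (g ** p) N"
      by (simp add: SL2_inverse p' flip: matrix_mul_assoc)
    then show "\<exists>g\<in>D. eqM r g N"
      using sub(3)[OF g(1) p(1)] by blast
  qed
qed

text \<open>Elementary matrices over the residue field are commutators of diagonal and elementary
  ones, and commutators modulo \<open>t\<close> may be computed with lifts from
  \<open>H\<close>.\<close>

lemma surj_mod_one:
  assumes H: "\<And>B. t dvd det B - 1 \<Longrightarrow> \<exists>A\<in>H. eqM t A B"
    and inv: "\<And>A. A \<in> H \<Longrightarrow> A ** \<iota> A = mat 1"
    and D: "subSL D" and comm: "\<And>A B. A \<in> H \<Longrightarrow> B \<in> H \<Longrightarrow> A ** B ** \<iota> A ** \<iota> B \<in> D"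
  shows "surj_mod 1 D"
proof -
  note sub = subSL_D[OF D]
  have cm: "\<exists>g\<in>D. eqM t g (A ** B ** adj2 A ** adj2 B)" if AB: "A \<in> SL2" "B \<in> SL2" for A B
  proof -
    have H': "\<exists>A'\<in>H. eqM t A' A \<and> eqM t (\<iota> A') (adj2 A)" if A: "A \<in> SL2" for A
    proof -
      obtain A' where A': "A' \<in> H" "eqM t A' A"
        using H[of A] A by (auto simp: SL2_def)
      have "t dvd det A' - 1"
        using eqM_det[OF A'(2)] A by (simp add: SL2_def)
      then have "t dvd det (\<iota> A') * (det A' - 1)"
        by (rule dvd_mult)
      moreover have "det (\<iota> A') * det A' = 1"
        using inv[OF A'(1)] by (metis det_I det_mul mult.commute)
      ultimately have "t dvd det (\<iota> A') - 1"
        by (simp add: distrib_left add.commute)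
      then have "eqM t (scal (det (\<iota> A')) ** adj2 A') (scal 1 ** adj2 A)"
        using A' by (intro eqM_mult eqM_adj2) auto
      then have "eqM t (\<iota> A') (adj2 A)"
        using inverse_adj2[OF inv[OF A'(1)]] by (simp add: scal_one)
      then show ?thesis
        using A' by blast
    qed
    obtain A' B' where "A' \<in> H" "eqM t A' A" "eqM t (\<iota> A') (adj2 A)"
        "B' \<in> H" "eqM t B' B" "eqM t (\<iota> B') (adj2 B)"
      using AB H' by meson
    then show ?thesis
      using comm[of A' B'] eqM_mult by blast
  qed
  obtain l where l: "\<not> t dvd l" "\<not> t dvd 1 + l"
    using ex_scalar by blast
  then obtain l' where l': "l * l' = 1"
    using unitE by blast
  have "\<not> t dvd 1 + l\<^sup>2"
    using l(2) sq_add[of 1 l] by (metis one_power2 t_prime_power2)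
  \<comment> \<open>The commutator of \<open>dg l l'\<close> and \<open>up z\<close> is
    \<open>up ((1 + l\<^sup>2) * z)\<close>; taking \<open>z = e * x\<close> yields
    \<open>up x\<close>.\<close>
  then obtain e where e: "(1 + l\<^sup>2) * e = 1"
    using unitE by blast
  show ?thesis
    unfolding surj_mod_def power_one_right
  proof
    fix M :: "'a^2^2"
    assume M: "M \<in> SL2"
    show "\<exists>g\<in>D. eqM t g M"
    proof (rule SL2_induct[OF M])
      show "\<exists>g\<in>D. eqM t g (A ** B)" if "\<exists>g\<in>D. eqM t g A" "\<exists>g\<in>D. eqM t g B" for A B
        using that sub(3) eqM_mult[of t _ A _ B] by blast
      fix x
      have "e * x + l * (l * (e * x)) = (1 + l\<^sup>2) * e * x"
        by (simp add: algebra_simps power2_eq_square)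
      then have ex: "e * x + l * (l * (e * x)) = x"
        by (simp add: e)
      have "dg l l' ** up (e * x) ** adj2 (dg l l') ** adj2 (up (e * x)) =
          mat2 (l * l') (l * l' * (e * x) + l * (l * (e * x))) 0 (l * l')"
        by (simp add: ac_simps)
      also have "\<dots> = up x"
        unfolding l' mult_1 ex ..
      finally have eq: "dg l l' ** up (e * x) ** adj2 (dg l l') ** adj2 (up (e * x)) = up x" .
      show "\<exists>g\<in>D. eqM t g (up x)"
        using cm[of "dg l l'" "up (e * x)"] unfolding eq by (simp add: l')
      have "dg l' l ** lo (e * x) ** adj2 (dg l' l) ** adj2 (lo (e * x)) =
          mat2 (l * l') 0 (l * l' * (e * x) + l * (l * (e * x))) (l * l')"
        by (simp add: ac_simps)
      also have "\<dots> = lo x"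
        unfolding l' mult_1 ex ..
      finally have eq: "dg l' l ** lo (e * x) ** adj2 (dg l' l) ** adj2 (lo (e * x)) = lo x" .
      show "\<exists>g\<in>D. eqM t g (lo x)"
        using cm[of "dg l' l" "lo (e * x)"] unfolding eq by (simp add: l' mult.commute[of l' l])
    qed
  qed
qed

end

section \<open>Subgroups of index two\<close>

lemma (in group) inv_cancel:
  assumes "x \<in> carrier G" "y \<in> carrier G"
  shows "x \<otimes> (inv x \<otimes> y) = y" "inv x \<otimes> (x \<otimes> y) = y"
  using assms by (simp_all flip: m_assoc)

text \<open>The conjugate is \<open>(x k)\<^sup>2\<close> times the inverses of \<open>k\<close> and
  of \<open>x\<^sup>2\<close>.\<close>

lemma (in group) conj_mem_of_squares:
  assumes K: "subgroup K G" and sq: "\<And>x. x \<in> carrier G \<Longrightarrow> x \<otimes> x \<in> K"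
    and x: "x \<in> carrier G" and k: "k \<in> K"
  shows "x \<otimes> k \<otimes> inv x \<in> K"
proof -
  have k': "k \<in> carrier G"
    using subgroup.mem_carrier[OF K k] .
  have "x \<otimes> k \<otimes> inv x = (x \<otimes> k) \<otimes> (x \<otimes> k) \<otimes> inv k \<otimes> (inv x \<otimes> inv x)"
    using x k' by (simp add: m_assoc inv_cancel)
  also have "\<dots> \<in> K"
    using x k k' by (intro subgroup.m_closed[OF K] subgroup.m_inv_closed[OF K] sq) auto
  finally show ?thesis .
qed

text \<open>\<open>K\<close> is normal and contains the square of \<open>a\<close>, so adjoining
  \<open>a\<close> adds at most one coset.\<close>

lemma (in group) subgroup_extend:
  assumes K: "subgroup K G" and sq: "\<And>x. x \<in> carrier G \<Longrightarrow> x \<otimes> x \<in> K"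
    and a: "a \<in> carrier G"
  shows "subgroup (K \<union> (K #> a)) G"
proof -
  note Kc = subgroup.mem_carrier[OF K] and Km = subgroup.m_closed[OF K] and Ki = subgroup.m_inv_closed[OF K]
  have rc: "x \<in> K #> a \<longleftrightarrow> (\<exists>k\<in>K. x = k \<otimes> a)" for x
    by (auto simp: r_coset_def)
  have conj: "a \<otimes> k = (a \<otimes> k \<otimes> inv a) \<otimes> a" if "k \<in> K" for k
    using a Kc[OF that] by (simp add: m_assoc)
  have cK: "a \<otimes> k \<otimes> inv a \<in> K" if "k \<in> K" for k
    using conj_mem_of_squares[OF K sq a that] .
  show ?thesis
  proof (rule subgroupI)
    show "K \<union> (K #> a) \<subseteq> carrier G"
      using Kc a by (auto simp: rc)
    show "K \<union> (K #> a) \<noteq> {}"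
      using subgroup.one_closed[OF K] by blast
  next
    fix x
    assume "x \<in> K \<union> (K #> a)"
    then consider "x \<in> K" | k where "k \<in> K" "x = k \<otimes> a"
      by (auto simp: rc)
    then show "inv x \<in> K \<union> (K #> a)"
    proof cases
      case 2
      have x: "x \<in> carrier G"
        using 2 a Kc by simp
      have "inv x = inv (x \<otimes> x) \<otimes> x"
        using x by (simp add: inv_mult_group m_assoc)
      also have "\<dots> = (inv (x \<otimes> x) \<otimes> k) \<otimes> a"
        using x 2 a Kc by (simp add: m_assoc)
      finally show ?thesis
        using Km[OF Ki[OF sq[OF x]] 2(1)] by (auto simp: rc)
    qed (use Ki in auto)
  next
    fix x y
    assume "x \<in> K \<union> (K #> a)" "y \<in> K \<union> (K #> a)"
    then consider "x \<in> K" "y \<in> K" | k where "k \<in> K" "x \<in> K" "y = k \<otimes> a"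
      | k where "k \<in> K" "x = k \<otimes> a" "y \<in> K" | k l where "k \<in> K" "x = k \<otimes> a" "l \<in> K" "y = l \<otimes> a"
      by (auto simp: rc)
    then show "x \<otimes> y \<in> K \<union> (K #> a)"
    proof cases
      case 2
      then have "x \<otimes> y = (x \<otimes> k) \<otimes> a"
        using a Kc by (simp add: m_assoc)
      then show ?thesis
        using Km[OF 2(2,1)] by (auto simp: rc)
    next
      case 3
      have "x \<otimes> y = k \<otimes> (a \<otimes> y)"
        using 3 a Kc by (simp add: m_assoc)
      also have "\<dots> = (k \<otimes> (a \<otimes> y \<otimes> inv a)) \<otimes> a"
        using 3 a Kc by (simp add: m_assoc)
      finally show ?thesis
        using Km[OF 3(1) cK[OF 3(3)]] by (auto simp: rc)
    next
      case 4
      have "x \<otimes> y = k \<otimes> (a \<otimes> l \<otimes> inv a) \<otimes> (a \<otimes> a)"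
        using 4 a Kc by (simp add: m_assoc inv_cancel)
      then show ?thesis
        using Km[OF Km[OF 4(1) cK[OF 4(3)]] sq[OF a]] by simp
    qed (use Km in auto)
  qed
qed

text \<open>The quotient by \<open>N\<close> is an elementary abelian 2-group, so a subgroup maximal among those
  avoiding \<open>x\<close> is a hyperplane.\<close>

lemma (in group) ex_index2_subgroup:
  assumes N: "subgroup N G" and sq: "\<And>x. x \<in> carrier G \<Longrightarrow> x \<otimes> x \<in> N"
    and x: "x \<in> carrier G" "x \<notin> N"
  obtains K where "subgroup K G" "N \<subseteq> K" "x \<notin> K" "card (rcosets K) = 2"
proof -
  define A where "A = {K. subgroup K G \<and> N \<subseteq> K \<and> x \<notin> K}"
  have "\<exists>M\<in>A. \<forall>X\<in>A. M \<subseteq> X \<longrightarrow> X = M"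
  proof (rule subset_Zorn_nonempty)
    show "A \<noteq> {}"
      using N x A_def by blast
    fix C
    assume C: "C \<noteq> {}" "subset.chain A C"
    then have CA: "C \<subseteq> A"
      by (auto simp: subset_chain_def)
    have "subgroup (\<Union>C) G"
    proof (rule subgroupI)
      show "\<Union>C \<subseteq> carrier G"
        using CA subgroup.subset by (fastforce simp: A_def)
      show "\<Union>C \<noteq> {}"
        using C CA subgroup.one_closed by (fastforce simp: A_def)
      show "inv a \<in> \<Union>C" if "a \<in> \<Union>C" for a
        using that CA subgroup.m_inv_closed by (fastforce simp: A_def)
      fix a b
      assume "a \<in> \<Union>C" "b \<in> \<Union>C"
      then obtain K L where KL: "K \<in> C" "a \<in> K" "L \<in> C" "b \<in> L"
        by blast
      then have "K \<subseteq> L \<or> L \<subseteq> K"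
        using C(2) by (auto simp: subset_chain_def)
      then obtain M where "M \<in> C" "a \<in> M" "b \<in> M"
        using KL by blast
      moreover from this have "subgroup M G"
        using CA by (auto simp: A_def)
      ultimately show "a \<otimes> b \<in> \<Union>C"
        using subgroup.m_closed[of M G a b] by blast
    qed
    then show "\<Union>C \<in> A"
      using C CA by (auto simp: A_def)
  qed
  then obtain K where K: "subgroup K G" "N \<subseteq> K" "x \<notin> K"
    and max: "\<And>X. X \<in> A \<Longrightarrow> K \<subseteq> X \<Longrightarrow> X = K"
    by (auto simp: A_def)
  have sqK: "a \<otimes> a \<in> K" if "a \<in> carrier G" for a
    using sq[OF that] K(2) by blast
  \<comment> \<open>By maximality, adjoining any \<open>a\<close> outside \<open>K\<close> captures
    \<open>x\<close>, so \<open>K\<close> has only one other coset.\<close>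
  have cos: "K #> a = K #> x" if a: "a \<in> carrier G" "a \<notin> K" for a
  proof -
    have "a \<in> K #> a"
      using a K by (intro rcos_self)
    moreover have "subgroup (K \<union> (K #> a)) G"
      using subgroup_extend[OF K(1) sqK a(1)] .
    ultimately have "K \<union> (K #> a) \<notin> A"
      using max[of "K \<union> (K #> a)"] a(2) by blast
    then have "x \<in> K #> a"
      using K \<open>subgroup (K \<union> (K #> a)) G\<close> by (auto simp: A_def)
    then show ?thesis
      using repr_independence a(1) K(1) by blast
  qed
  have K1: "K #> a = K" if "a \<in> K" for a
    using subgroup.rcos_const[OF K(1) is_group that] .
  have "rcosets K = {K, K #> x}"
    unfolding RCOSETS_def
  proof (intro equalityI subsetI)
    fix X
    assume "X \<in> (\<Union>a\<in>carrier G. {K #> a})"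
    then show "X \<in> {K, K #> x}"
      using cos K1 by blast
  next
    fix X
    assume "X \<in> {K, K #> x}"
    then have "X = K #> \<one> \<or> X = K #> x"
      using K1[OF subgroup.one_closed[OF K(1)]] by blast
    then show "X \<in> (\<Union>a\<in>carrier G. {K #> a})"
      using x(1) one_closed by blast
  qed
  moreover have "K \<noteq> K #> x"
    using rcos_self[OF x(1) K(1)] K(3) by blast
  ultimately have "card (rcosets K) = 2"
    by simp
  then show ?thesis
    using that K by blast
qed

section \<open>The general linear group\<close>

lemma GL2_simps [simp]:
  "A \<in> carrier GL2 \<longleftrightarrow> det A dvd 1" "mult GL2 A B = A ** B" "one GL2 = mat 1"
  by (simp_all add: GL2_def)

lemma group_GL2: "group (GL2 :: ('a::comm_ring_1^2^2) monoid)"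
proof (rule groupI)
  fix A :: "'a^2^2"
  assume "A \<in> carrier GL2"
  then obtain e where e: "1 = det A * e"
    by (auto elim: dvdE)
  have "scal e ** adj2 A ** A = mat 1"
    using e by (simp add: mult_adj2 scal_one mult.commute flip: matrix_mul_assoc)
  moreover have "det (scal e ** adj2 A) dvd 1"
  proof (rule dvdI)
    have "det (scal e ** adj2 A) * det A = (det A * e) * (det A * e)"
      unfolding det_scal_mult det_adj2 power2_eq_square by (simp only: ac_simps)
    then show "1 = det (scal e ** adj2 A) * det A"
      using e by simp
  qed
  ultimately show "\<exists>y\<in>carrier GL2. y \<otimes>\<^bsub>GL2\<^esub> A = \<one>\<^bsub>GL2\<^esub>"
    by auto
next
  fix A B :: "'a^2^2"
  assume "A \<in> carrier GL2" "B \<in> carrier GL2"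
  then show "A \<otimes>\<^bsub>GL2\<^esub> B \<in> carrier GL2"
    using mult_dvd_mono[of "det A" 1 "det B" 1] by (simp add: det_mul)
qed (auto simp: matrix_mul_assoc)

abbreviation inv2 :: "'a::comm_ring_1^2^2 \<Rightarrow> 'a^2^2" where
  "inv2 A \<equiv> inv\<^bsub>GL2\<^esub> A"

lemma inv2:
  assumes "det A dvd 1"
  shows "A ** inv2 A = mat 1" "inv2 A ** A = mat 1"
  using group.r_inv[OF group_GL2, of A] group.l_inv[OF group_GL2, of A] assms by simp_all

lemma inv2_eq:
  assumes "det A * e = 1"
  shows "inv2 A = scal e ** adj2 A"
proof -
  have A: "det A dvd 1"
    using assms by (metis dvd_triv_left)
  have "det A * det (inv2 A) = 1"
    using inv2(1)[OF A] by (metis det_I det_mul)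
  moreover have "det (inv2 A) * (det A * e) = (det A * det (inv2 A)) * e"
    by (simp only: ac_simps)
  ultimately have "det (inv2 A) = e"
    using assms by simp
  then show ?thesis
    using inverse_adj2[OF inv2(1)[OF A]] by simp
qed

lemma inv2_SL2: "A \<in> SL2 \<Longrightarrow> inv2 A = adj2 A"
  using inv2_eq[of A 1] by (simp add: SL2_def scal_one)

text \<open>The trace of \<open>Ad(h)\<close> is the product of the traces of \<open>h\<close> and
  of its inverse.\<close>

lemma trace_Ad_eq:
  assumes "det h * e = 1"
  shows "trace_Ad h = e * (tr2 h)\<^sup>2"
proof -
  obtain a b c d where h: "h = mat2 a b c d"
    by (metis mat2_cases)
  have elem: "elem_mat 1 1 = mat2 1 0 0 0" "elem_mat 1 2 = mat2 0 1 0 0"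
    "elem_mat 2 1 = mat2 0 0 1 0" "elem_mat 2 2 = mat2 0 0 0 1"
    by (rule mat2_eqI; simp add: elem_mat_def)+
  have "trace_Ad h = e * (a * d + a * a + d * d + d * a)"
    unfolding trace_Ad_def inv2_eq[OF assms] sum_2 elem
    by (simp add: h algebra_simps)
  then show ?thesis
    by (simp add: h power2_eq_square algebra_simps)
qed

section \<open>Adic closure and the subgroup \<open>H'\<close>\<close>

lemma padic_closure_iff: "M \<in> padic_closure t S \<longleftrightarrow> (\<forall>n. \<exists>A\<in>S. eqM (t ^ n) A M)"
  by (simp add: padic_closure_def eqM_def)

text \<open>An element outside \<open>N\<close> is avoided by an index 2 subgroup containing
  \<open>N\<close>. This subgroup contains a congruence subgroup of \<open>H\<close>, so it is open
  and therefore closed.\<close>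

lemma Hprime_subset:
  fixes t :: "'a::idom"
  assumes H: "subgroup H GL2" and cl: "padic_closure t H = H"
    and N: "subgroup N GL2" "N \<subseteq> H" and sq: "\<And>h. h \<in> H \<Longrightarrow> h ** h \<in> N"
    and op: "\<And>h. h \<in> H \<Longrightarrow> eqM (t ^ m) h (mat 1) \<Longrightarrow> h \<in> N"
  shows "Hprime t H \<subseteq> N"
proof
  fix h
  assume h: "h \<in> Hprime t H"
  then have hH: "h \<in> H"
    by (simp add: Hprime_def)
  let ?H = "GL2\<lparr>carrier := H\<rparr>"
  have gH: "group ?H"
    using subgroup.subgroup_is_group[OF H group_GL2] .
  show "h \<in> N"
  proof (rule ccontr)
    assume "h \<notin> N"
    moreover have "subgroup N ?H"
      using group.subgroup_incl[OF group_GL2 N(1) H N(2)] .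
    ultimately obtain K where K: "subgroup K ?H" "N \<subseteq> K" "h \<notin> K" "card (rcosets\<^bsub>?H\<^esub> K) = 2"
      using group.ex_index2_subgroup[OF gH, of N h] sq hH by auto
    have KG: "subgroup K GL2"
      using group.incl_subgroup[OF group_GL2 H K(1)] .
    have KH: "K \<subseteq> H"
      using subgroup.subset[OF K(1)] by simp
    have "padic_closure t K \<subseteq> K"
    proof
      fix M
      assume M: "M \<in> padic_closure t K"
      then have "M \<in> padic_closure t H"
        using KH by (auto simp: padic_closure_iff)
      then have MH: "M \<in> H"
        by (simp add: cl)
      obtain A where A: "A \<in> K" "eqM (t ^ m) A M"
        using M padic_closure_iff by blast
      have dA: "det A dvd 1"
        using subgroup.mem_carrier[OF KG A(1)] by simp
      have iA: "inv2 A \<in> K"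
        using subgroup.m_inv_closed[OF KG A(1)] .
      have "eqM (t ^ m) (M ** inv2 A) (A ** inv2 A)"
        by (rule eqM_mult[OF eqM_sym[OF A(2)]]) simp
      then have "eqM (t ^ m) (M ** inv2 A) (mat 1)"
        by (simp add: inv2 dA)
      moreover have "M ** inv2 A \<in> H"
        using subgroup.m_closed[OF H MH] iA KH by auto
      ultimately have "M ** inv2 A \<in> K"
        using op K(2) by blast
      then have "M ** inv2 A ** A \<in> K"
        using subgroup.m_closed[OF KG _ A(1)] by simp
      then show "M \<in> K"
        by (simp add: inv2 dA flip: matrix_mul_assoc)
    qed
    moreover have "K \<subseteq> padic_closure t K"
      unfolding padic_closure_iff subset_iff using eqM_refl by blast
    ultimately have "K \<in> closed_index2_subgroups t H"
      using KG KH K(4) by (simp add: closed_index2_subgroups_def)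
    then show False
      using h K(3) by (simp add: Hprime_def)
  qed
qed

lemma subSL_of_subgroup:
  assumes "subgroup D GL2" "D \<subseteq> SL2"
  shows "subSL D"
  using assms subgroup.one_closed[OF assms(1)] subgroup.m_closed[OF assms(1)]
    subgroup.m_inv_closed[OF assms(1)] inv2_SL2
  unfolding subSL_def by (metis GL2_simps(2,3) subsetD)

lemma derived_subset_SL2:
  assumes "subgroup H GL2"
  shows "derived GL2 H \<subseteq> SL2"
proof -
  have "subgroup SL2 (GL2 :: ('a::comm_ring_1^2^2) monoid)"
  proof (rule group.subgroupI[OF group_GL2])
    show "(SL2 :: ('a^2^2) set) \<noteq> {}"
      using SL2_one by blast
  qed (auto simp: SL2_def det_mul inv2_SL2[unfolded SL2_def])
  moreover have "derived_set GL2 H \<subseteq> SL2"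
  proof -
    have "det (A ** B ** inv2 A ** inv2 B) = 1" if "A \<in> H" "B \<in> H" for A B
    proof -
      have "det A dvd 1" "det B dvd 1"
        using that subgroup.mem_carrier[OF assms] by auto
      then have "det A * det (inv2 A) = 1" "det B * det (inv2 B) = 1"
        by (metis inv2(1) det_I det_mul)+
      moreover have "det (A ** B ** inv2 A ** inv2 B) = (det A * det (inv2 A)) * (det B * det (inv2 B))"
        unfolding det_mul by (simp only: ac_simps)
      ultimately show ?thesis
        by simp
    qed
    then show ?thesis
      by (auto simp: SL2_def)
  qed
  ultimately show ?thesis
    unfolding derived_def using group.generate_subgroup_incl[OF group_GL2] by blast
qed

section \<open>Adjoint traces and the derived group\<close>

context dvr2
begin

context
  fixes H :: "('a^2^2) set"
  assumes H: "subgroup H GL2" and cl: "padic_closure t H = H"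
    and image: "\<And>B. t dvd det B - 1 \<Longrightarrow> \<exists>A\<in>H. eqM t A B"
    and traces: "top_generated_subring t (trace_Ad ` Hprime t H) = {x\<^sup>2 | x. True}"
begin

lemma H_inverse:
  assumes "h \<in> H"
  shows "h ** inv2 h = mat 1" "inv2 h ** h = mat 1"
  using inv2[of h] subgroup.mem_carrier[OF H assms] by simp_all

lemma subSL_derived: "subSL (derived GL2 H)"
  by (rule subSL_of_subgroup[OF _ derived_subset_SL2[OF H]])
    (rule group.derived_is_subgroup[OF group_GL2 subgroup.subset[OF H]])

lemma derived_normalized:
  assumes "h \<in> H" "g \<in> derived GL2 H"
  shows "h ** g ** inv2 h \<in> derived GL2 H"
proof -
  have "derived GL2 H \<lhd> GL2\<lparr>carrier := H\<rparr>"
    using group.derived_subgroup_is_normal[OF group_GL2 H] .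
  from normal.inv_op_closed2[OF this, of h g] assms show ?thesis
    using group.m_inv_consistent[OF group_GL2 H] by simp
qed

text \<open>If \<open>H\<close> is congruent modulo \<open>t\<^sup>2\<close> to scalar multiples of the image of \<open>\<Phi>\<close>, then the
  adjoint traces of \<open>H'\<close> are fourth powers modulo \<open>t ^ 4\<close>, and \<open>t\<^sup>2\<close> is not in the
  ring that they generate.\<close>

lemma no_frobenius_shape:
  assumes mult: "\<And>A B. \<Phi> (A ** B) = \<Phi> A ** \<Phi> B"
    and SL: "\<And>M. M \<in> SL2 \<Longrightarrow> \<Phi> M \<in> SL2" and tr: "\<And>M. tr2 (\<Phi> M) = (tr2 M)\<^sup>2"
    and shape: "\<And>h. h \<in> H \<Longrightarrow> \<exists>l. \<exists>M\<in>SL2. eqM (t\<^sup>2) h (scal l ** \<Phi> M)"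
  shows False
proof -
  have \<Phi>1: "\<Phi> (mat 1) = mat 1"
  proof -
    have "\<Phi> (mat 1) ** \<Phi> (mat 1) = \<Phi> (mat 1)"
      by (simp flip: mult)
    then have "adj2 (\<Phi> (mat 1)) ** (\<Phi> (mat 1) ** \<Phi> (mat 1)) = adj2 (\<Phi> (mat 1)) ** \<Phi> (mat 1)"
      by simp
    then show ?thesis
      using SL[of "mat 1"] by (simp add: matrix_mul_assoc SL2_inverse)
  qed
  have \<Phi>adj: "\<Phi> (adj2 M) = adj2 (\<Phi> M)" if "M \<in> SL2" for M
  proof -
    have "\<Phi> (adj2 M) ** \<Phi> M = mat 1"
      using that by (simp add: SL2_inverse \<Phi>1 flip: mult)
    then have "\<Phi> (adj2 M) ** \<Phi> M ** adj2 (\<Phi> M) = adj2 (\<Phi> M)"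
      by simp
    then show ?thesis
      using SL[OF that] by (simp add: SL2_inverse flip: matrix_mul_assoc)
  qed
  have det\<Phi>: "det (scal l ** \<Phi> M) = l\<^sup>2" if "M \<in> SL2" for l M
    using SL[OF that] by (simp add: det_scal_mult SL2_def)
  \<comment> \<open>The adjoint trace is the squared trace over the determinant. Squaring lifts a
    congruence of traces from \<open>t\<^sup>2\<close> to \<open>t ^ 4\<close>, so the determinant
    must be controlled modulo \<open>t ^ 4\<close>.\<close>
  define R where "R h l M \<longleftrightarrow> M \<in> SL2 \<and> t ^ 4 dvd det h - l\<^sup>2 \<and> eqM (t\<^sup>2) h (scal l ** \<Phi> M)" for h l M
  define N where "N = {h \<in> H. \<exists>l M. R h l M}"
  have unit: "\<exists>e. det h * e = 1" if "h \<in> H" for h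
    using subgroup.mem_carrier[OF H that] by (metis GL2_simps(1) dvdE)
  have "subgroup N GL2"
  proof (rule group.subgroupI[OF group_GL2])
    show "N \<subseteq> carrier GL2"
      using subgroup.subset[OF H] by (auto simp: N_def)
    have "R (mat 1) 1 (mat 1)"
      by (simp add: R_def \<Phi>1 scal_one)
    then show "N \<noteq> {}"
      using subgroup.one_closed[OF H] by (auto simp: N_def)
  next
    fix h
    assume "h \<in> N"
    then obtain l M where h: "h \<in> H" "R h l M"
      by (auto simp: N_def)
    obtain e where e: "det h * e = 1"
      using unit h by blast
    have inv: "inv2 h = scal e ** adj2 h"
      by (rule inv2_eq[OF e])
    have "eqM (t\<^sup>2) (scal e ** adj2 h) (scal e ** adj2 (scal l ** \<Phi> M))"
      using h(2) by (intro eqM_mult eqM_adj2) (auto simp: R_def)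
    then have "eqM (t\<^sup>2) (inv2 h) (scal (e * l) ** \<Phi> (adj2 M))"
      using h(2) by (simp only: inv adj2_scal_mult scal_mult_scal \<Phi>adj R_def)
    moreover have "t ^ 4 dvd det (inv2 h) - (e * l)\<^sup>2"
    proof -
      have "t ^ 4 dvd e\<^sup>2 * (det h - l\<^sup>2)"
        using h(2) by (intro dvd_mult) (simp add: R_def)
      then show ?thesis
        by (simp add: inv det_scal_mult distrib_left power_mult_distrib)
    qed
    ultimately have "R (inv2 h) (e * l) (adj2 M)"
      using h(2) by (simp add: R_def SL2_adj2)
    then show "inv2 h \<in> N"
      using subgroup.m_inv_closed[OF H h(1)] by (auto simp: N_def)
  next
    fix h h'
    assume "h \<in> N" "h' \<in> N"
    then obtain l M l' M' where h: "h \<in> H" "R h l M" and h': "h' \<in> H" "R h' l' M'"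
      by (auto simp: N_def)
    have "eqM (t\<^sup>2) (h ** h') (scal l ** \<Phi> M ** (scal l' ** \<Phi> M'))"
      using h h' by (intro eqM_mult) (auto simp: R_def)
    then have "eqM (t\<^sup>2) (h ** h') (scal (l * l') ** \<Phi> (M ** M'))"
      by (simp only: scal_mult_mult mult)
    moreover have "t ^ 4 dvd det (h ** h') - (l * l')\<^sup>2"
      unfolding det_mul power_mult_distrib using h h' by (intro dvd_diff_mult) (auto simp: R_def)
    ultimately have "R (h ** h') (l * l') (M ** M')"
      using h h' by (simp add: R_def SL2_mult)
    then show "h \<otimes>\<^bsub>GL2\<^esub> h' \<in> N"
      using subgroup.m_closed[OF H h(1) h'(1)] by (auto simp: N_def)
  qed
  moreover have "N \<subseteq> H"
    by (auto simp: N_def)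
  moreover have "h ** h \<in> N" if "h \<in> H" for h
  proof -
    obtain l M where M: "M \<in> SL2" "eqM (t\<^sup>2) h (scal l ** \<Phi> M)"
      using shape \<open>h \<in> H\<close> by blast
    have "eqM (t\<^sup>2) (h ** h) (scal l ** \<Phi> M ** (scal l ** \<Phi> M))"
      using M(2) by (intro eqM_mult)
    then have "eqM (t\<^sup>2) (h ** h) (scal (l * l) ** \<Phi> (M ** M))"
      by (simp only: scal_mult_mult mult)
    \<comment> \<open>Replacing the scalar \<open>l * l\<close> by \<open>det h\<close> makes the
      determinant condition for \<open>h ** h\<close> an exact equality.\<close>
    moreover have "t\<^sup>2 dvd l * l - det h"
      using dvd_diff_sym[OF eqM_det[OF M(2)]] M(1) by (simp only: det\<Phi> power2_eq_square)
    ultimately have "eqM (t\<^sup>2) (h ** h) (scal (det h) ** \<Phi> (M ** M))"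
      using eqM_scal eqM_trans by blast
    then have "R (h ** h) (det h) (M ** M)"
      using M(1) by (simp add: R_def SL2_mult det_mul power2_eq_square)
    moreover have "h ** h \<in> H"
      using subgroup.m_closed[OF H that that] by simp
    ultimately show ?thesis
      by (auto simp: N_def)
  qed
  moreover have "h \<in> N" if "h \<in> H" "eqM (t ^ 4) h (mat 1)" for h
  proof -
    have "t\<^sup>2 dvd t ^ 4"
      by (simp add: t_power_dvd_power)
    then have "eqM (t\<^sup>2) h (mat 1)"
      using that(2) eqM_dvd by blast
    moreover have "t ^ 4 dvd det h - 1"
      using eqM_det[OF that(2)] by simp
    ultimately have "R h 1 (mat 1)"
      by (simp add: R_def \<Phi>1 scal_one)
    then show ?thesis
      using that by (auto simp: N_def)
  qed
  ultimately have Hp: "Hprime t H \<subseteq> N"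
    by (rule Hprime_subset[OF H cl])
  \<comment> \<open>Sums of fourth powers are fourth powers in characteristic 2, and membership
    depends only on the class modulo \<open>t ^ 4\<close>, so this is a closed subring.\<close>
  define S where "S = {x. \<exists>y. t ^ 4 dvd x - y ^ 4}"
  have p4: "x ^ 4 = (x\<^sup>2)\<^sup>2" for x :: 'a
    by (simp flip: power_mult)
  have "closed_subring t S"
    unfolding closed_subring_def
  proof (intro conjI ballI subsetI)
    have "t ^ 4 dvd 0 - 0 ^ 4" "t ^ 4 dvd 1 - 1 ^ 4"
      by simp_all
    then show "0 \<in> S" "1 \<in> S"
      unfolding S_def by blast+
    fix x y
    assume "x \<in> S" "y \<in> S"
    then obtain a b where ab: "t ^ 4 dvd x - a ^ 4" "t ^ 4 dvd y - b ^ 4"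
      by (auto simp: S_def)
    have "t ^ 4 dvd (x + y) - (a + b) ^ 4"
      using dvd_diff_add[OF ab] by (simp only: p4 sq_add)
    then show "x + y \<in> S" "x - y \<in> S"
      by (auto simp: S_def)
    have "t ^ 4 dvd x * y - (a * b) ^ 4"
      using dvd_diff_mult[OF ab] by (simp only: power_mult_distrib)
    then show "x * y \<in> S"
      by (auto simp: S_def)
  next
    fix x
    assume "x \<in> padic_closure_elt t S"
    then obtain y where y: "y \<in> S" "t ^ 4 dvd y - x"
      unfolding padic_closure_elt_def by blast
    then obtain a where "t ^ 4 dvd y - a ^ 4"
      by (auto simp: S_def)
    with dvd_diff_sym[OF y(2)] have "t ^ 4 dvd x - a ^ 4"
      by (rule dvd_diff_trans)
    then show "x \<in> S"
      by (auto simp: S_def)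
  qed
  moreover have "trace_Ad h \<in> S" if "h \<in> N" for h
  proof -
    obtain l M where h: "h \<in> H" "R h l M"
      using \<open>h \<in> N\<close> by (auto simp: N_def)
    obtain e where e: "det h * e = 1"
      using unit h by blast
    have "eqM (t\<^sup>2) h (scal l ** \<Phi> M)"
      using h(2) by (simp add: R_def)
    then have "t\<^sup>2 dvd tr2 h - tr2 (scal l ** \<Phi> M)"
      unfolding eqM_iff using dvd_diff_add by blast
    also have "tr2 (scal l ** \<Phi> M) = l * (tr2 M)\<^sup>2"
      unfolding tr[symmetric] by (rule mat2_cases[of "\<Phi> M"]) (simp add: distrib_left)
    finally have "t\<^sup>2 dvd tr2 h + l * (tr2 M)\<^sup>2"
      by simp
    then have "t\<^sup>2 * t\<^sup>2 dvd (tr2 h + l * (tr2 M)\<^sup>2)\<^sup>2"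
      unfolding power2_eq_square[of "tr2 h + l * (tr2 M)\<^sup>2"] by (intro mult_dvd_mono)
    also have "(tr2 h + l * (tr2 M)\<^sup>2)\<^sup>2 = (tr2 h)\<^sup>2 + l\<^sup>2 * tr2 M ^ 4"
      by (simp only: sq_add power_mult_distrib p4)
    also have "t\<^sup>2 * t\<^sup>2 = t ^ 4"
      by (simp flip: power_add)
    finally have 1: "t ^ 4 dvd e * ((tr2 h)\<^sup>2 + l\<^sup>2 * tr2 M ^ 4)"
      by (rule dvd_mult)
    have 2: "t ^ 4 dvd e * tr2 M ^ 4 * (det h + l\<^sup>2)"
      using h(2) by (intro dvd_mult) (simp add: R_def)
    have "e * ((tr2 h)\<^sup>2 + l\<^sup>2 * tr2 M ^ 4) + e * tr2 M ^ 4 * (det h + l\<^sup>2) =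
        e * (tr2 h)\<^sup>2 + (det h * e) * tr2 M ^ 4"
      by (simp add: distrib_left distrib_right ac_simps)
    then have "t ^ 4 dvd trace_Ad h - tr2 M ^ 4"
      using dvd_add[OF 1 2] trace_Ad_eq[OF e] by (simp add: e)
    then show ?thesis
      by (auto simp: S_def)
  qed
  ultimately have "top_generated_subring t (trace_Ad ` Hprime t H) \<subseteq> S"
    using Hp unfolding top_generated_subring_def by blast
  \<comment> \<open>A fourth power congruent to \<open>t\<^sup>2\<close> modulo \<open>t ^ 4\<close>
    has a base divisible by \<open>t\<close>, so it vanishes modulo \<open>t ^ 4\<close>.\<close>
  then have "t\<^sup>2 \<in> S"
    unfolding traces by blast
  then obtain y where y: "t ^ 4 dvd t\<^sup>2 - y ^ 4"
    by (auto simp: S_def)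
  have "t dvd t ^ 4"
    by simp
  then have "t dvd t\<^sup>2 + y ^ 4"
    using y dvd_trans by auto
  then have "t dvd (y\<^sup>2)\<^sup>2"
    unfolding p4[symmetric] by (simp add: dvd_add_right_iff)
  then have "t dvd y"
    by (simp only: t_prime_power2)
  then have "t ^ 4 dvd y ^ 4"
    by (rule dvd_power_same)
  then have "t ^ 4 dvd t\<^sup>2"
    using y by (simp add: dvd_add_left_iff)
  then show False
    by (simp add: t_power_dvd_power)
qed

text \<open>If the induction step fails, the new layer has no nonscalar matrix, so the saturation
  \<open>E\<close> is rigid. \<open>H\<close> normalizes \<open>E\<close>, hence has the Frobenius
  shape, which the traces exclude.\<close>

lemma surj_mod_derived: "0 < n \<Longrightarrow> surj_mod n (derived GL2 H)"
proof (induction n rule: nat_induct_non_zero)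
  case 1
  show ?case
  proof (rule surj_mod_one[OF image _ subSL_derived])
    show "A ** inv2 A = mat 1" if "A \<in> H" for A
      using H_inverse that by blast
    show "A ** B ** inv2 A ** inv2 B \<in> derived GL2 H" if "A \<in> H" "B \<in> H" for A B
      unfolding derived_def by (rule generate.incl) (use that in auto)
  qed
next
  case (Suc n)
  define E where "E = {N \<in> SL2. \<exists>g\<in>derived GL2 H. \<exists>z. eqM (t ^ Suc n) N (scal (1 + t ^ n * z) ** g)}"
  show ?case
  proof (rule ccontr)
    assume "\<not> surj_mod (Suc n) (derived GL2 H)"
    then have "rigid n E"
      unfolding E_def
      using rigid_saturation[OF Suc.hyps subSL_derived Suc.IH] surj_mod_Suc[OF Suc.hyps subSL_derived Suc.IH]
      by blast
    then show False
    proof (rule rigid_normalizer)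
      fix \<Phi> :: "'a^2^2 \<Rightarrow> 'a^2^2"
      assume \<Phi>: "\<And>A B. \<Phi> (A ** B) = \<Phi> A ** \<Phi> B" "\<And>M. M \<in> SL2 \<Longrightarrow> \<Phi> M \<in> SL2"
          "\<And>M. tr2 (\<Phi> M) = (tr2 M)\<^sup>2"
        and shape: "\<And>h h'. h ** h' = mat 1 \<Longrightarrow> (\<And>M. M \<in> E \<Longrightarrow> h ** M ** h' \<in> E) \<Longrightarrow>
          \<exists>l. \<exists>M\<in>SL2. eqM (t\<^sup>2) h (scal l ** \<Phi> M)"
      have "\<exists>l. \<exists>M\<in>SL2. eqM (t\<^sup>2) h (scal l ** \<Phi> M)" if "h \<in> H" for h
      proof (rule shape)
        show "h ** inv2 h = mat 1"
          using H_inverse that by blast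
        show "h ** M ** inv2 h \<in> E" if "M \<in> E" for M
          unfolding E_def
          by (rule saturation_normalized[OF H_inverse(1)[OF \<open>h \<in> H\<close>]])
            (use that derived_normalized[OF \<open>h \<in> H\<close>] in \<open>auto simp: E_def\<close>)
      qed
      then show False
        using no_frobenius_shape \<Phi> by blast
    qed
  qed
qed

lemma closure_derived: "padic_closure t (derived GL2 H) = SL2"
proof (intro equalityI subsetI)
  fix M
  assume M: "M \<in> padic_closure t (derived GL2 H)"
  have "det M - 1 = 0"
  proof (rule Inter_powers)
    fix n
    obtain A where A: "A \<in> derived GL2 H" "eqM (t ^ n) A M"
      using M padic_closure_iff by blast
    then have "det A = 1"
      using subSL_D(1)[OF subSL_derived] by (simp add: SL2_def)
    then show "t ^ n dvd det M - 1"
      using eqM_det[OF eqM_sym[OF A(2)]] by simp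
  qed
  then show "M \<in> SL2"
    unfolding SL2_def by (metis (mono_tags) eq_iff_diff_eq_0 mem_Collect_eq)
next
  fix M :: "'a^2^2"
  assume M: "M \<in> SL2"
  show "M \<in> padic_closure t (derived GL2 H)"
    unfolding padic_closure_iff
  proof
    fix n
    \<comment> \<open>Level \<open>Suc n\<close>, because surjectivity is available at positive
      levels and \<open>n\<close> may be 0.\<close>
    obtain A where "A \<in> derived GL2 H" "eqM (t ^ Suc n) A M"
      using surj_mod_derived[of "Suc n"] M unfolding surj_mod_def by blast
    then show "\<exists>A\<in>derived GL2 H. eqM (t ^ n) A M"
      using eqM_dvd[of "t ^ Suc n" A M "t ^ n"] by (auto simp del: power_Suc simp: t_power_dvd_power)
  qed
qed

end

end

theorem mainTheorem17:
  fixes unif :: "'a::idom"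
    and H :: "('a^2^2) set"
  assumes dvr: "dvr_uniformizer unif"
    and complete: "padic_complete unif"
    and char2: "(2::'a) = 0"
    and fin_res: "finite (residue_field unif)"
    and card_res: "card (residue_field unif) > 9"
    and H_subgroup: "subgroup H GL2"
    and H_closed: "padic_closure unif H = H"
    and H_image: "\<forall>B::'a^2^2. unif dvd (det B - 1) \<longrightarrow>
                    (\<exists>A\<in>H. \<forall>i j. unif dvd (A$i$j - B$i$j))"
    and trace_gen: "top_generated_subring unif (trace_Ad ` Hprime unif H) = {x ^ 2 | x. True}"
  shows "padic_closure unif (derived GL2 H) = SL2"
proof -
  interpret dvr_char2 unif
    using dvr char2 by unfold_locales
  interpret dvr2 unif
    using residue_field_perfect[OF fin_res] residue_field_ex_scalar card_res by unfold_locales auto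
  show ?thesis
    using closure_derived[OF H_subgroup H_closed _ trace_gen] H_image by (simp only: eqM_def)
qed

end
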